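(* Let $R$ be any noetherian local ring. Let $\mathfrak p,\mathfrak q$ be prime ideals of $R$ of the same codimension such that $\dim\big(\frac{R}{\mathfrak p+\mathfrak q}\big)\le\dim\frac{R}{\mathfrak p}-2$. Then $\frac{R}{\mathfrak p\mathfrak q}$ is not Cohen-Macaulay.
   Context: The codimension of a prime $\mathfrak p$ of $R$ is $\dim R-\dim R/\mathfrak p$. *)

theory Defs
  imports "HOL-Algebra.Algebra" "HOL-Library.Extended_Nat"
begin

locale noetherian_local_ring = cring R + noetherian_ring R for R (structure) +
  assumes ex1_maximalideal: "\<exists>!m. maximalideal m R"

definition max_ideal :: "('a, 'b) ring_scheme \<Rightarrow> 'a set"
  where "max_ideal R = (THE m. maximalideal m R)"

text \<open>The supremum of an empty set of extended naturals is \<open>0\<close>, so the zero ring gets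
  dimension \<open>0\<close> here; for nonzero rings this is the usual Krull dimension.\<close>

definition krull_dim :: "('a, 'b) ring_scheme \<Rightarrow> enat"
  where "krull_dim R = Sup {enat n | n. \<exists>P.
    (\<forall>i\<le>n. primeideal (P i) R) \<and> (\<forall>i<n. P i \<subset> P (Suc i))}"

text \<open>The subtraction is never truncated, as the dimension of a quotient is at most that of
  the ring.\<close>

definition codim :: "('a, 'b) ring_scheme \<Rightarrow> 'a set \<Rightarrow> enat"
  where "codim R I = krull_dim R - krull_dim (R Quot I)"

text \<open>That the \<open>i\<close>-th entry is a nonzerodivisor modulo the ideal generated by the
  preceding ones is expressed by ideal membership rather than in the quotient ring.\<close>

definition regular_sequence :: "('a, 'b) ring_scheme \<Rightarrow> 'a list \<Rightarrow> bool"
  where "regular_sequence R xs \<longleftrightarrow>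
    set xs \<subseteq> carrier R \<and>
    Idl\<^bsub>R\<^esub> (set xs) \<noteq> carrier R \<and>
    (\<forall>i<length xs. \<forall>a\<in>carrier R.
      xs ! i \<otimes>\<^bsub>R\<^esub> a \<in> Idl\<^bsub>R\<^esub> (set (take i xs)) \<longrightarrow> a \<in> Idl\<^bsub>R\<^esub> (set (take i xs)))"

text \<open>The next two notions are meant for noetherian local rings only.\<close>

definition ring_depth :: "('a, 'b) ring_scheme \<Rightarrow> enat"
  where "ring_depth R = Sup {enat (length xs) | xs.
    regular_sequence R xs \<and> set xs \<subseteq> max_ideal R}"

definition cohen_macaulay :: "('a, 'b) ring_scheme \<Rightarrow> bool"
  where "cohen_macaulay R \<longleftrightarrow> ring_depth R = krull_dim R"

end

theory Submission
  imports Defs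
begin

text \<open>
  Modulo \<open>J = \<pp>\<qq>\<close> the ideals \<open>\<pp>\<close> and \<open>\<qq>\<close> annihilate each other, and since \<open>R\<close> has finite
  dimension the equality of codimensions makes them incomparable, so neither lies in \<open>J\<close>.
  If \<open>R/J\<close> were Cohen-Macaulay, its depth \<open>d\<close> would be at least \<open>dim R/\<pp>\<close>, hence at least
  \<open>dim R/(\<pp> + \<qq>) + 2\<close>. An ideal \<open>I\<close> annihilating a nonzero element of \<open>R/J\<close> satisfies
  \<open>dim R/I \<ge> d\<close>, so \<open>\<pp> + \<qq>\<close> contains some \<open>x = a + b\<close>, with \<open>a \<in> \<pp>\<close> and \<open>b \<in> \<qq>\<close>, that is
  regular on \<open>R/J\<close>. The ring \<open>R/(J + R x)\<close> has depth \<open>d - 1\<close>, while \<open>(\<pp> + \<qq>) a \<subseteq> J + R x\<close>; hence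
  \<open>a \<in> J + R x\<close>, say \<open>a \<equiv> c x\<close> and \<open>b \<equiv> (1 - c) x\<close> modulo \<open>J\<close>. One of \<open>c\<close> and \<open>1 - c\<close> is a unit,
  so \<open>x\<close> kills \<open>\<qq>\<close> or \<open>\<pp>\<close> modulo \<open>J\<close>, and that ideal lies in \<open>J\<close>, a contradiction.

  Quotients and localisations are avoided: regularity is expressed modulo an ideal of \<open>R\<close>, and ideals
  of \<open>R\<^sub>P\<close> are replaced by ideals of \<open>R\<close> saturated with respect to the complement of \<open>P\<close>.
\<close>

section \<open>Sums, colons and saturations of ideals\<close>

locale noetherian_cring = cring R + noetherian_ring R for R (structure)

sublocale noetherian_local_ring \<subseteq> noetherian_cring ..

context ring
begin

lemma ideal_subset: "ideal I R \<Longrightarrow> I \<subseteq> carrier R"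
  by (auto dest: ideal.Icarr)

lemma ideal_add: "\<lbrakk>ideal I R; a \<in> I; b \<in> I\<rbrakk> \<Longrightarrow> a \<oplus> b \<in> I"
  by (simp add: additive_subgroup.a_closed ideal.axioms(1))

lemma ideal_minus: "\<lbrakk>ideal I R; a \<in> I; b \<in> I\<rbrakk> \<Longrightarrow> a \<ominus> b \<in> I"
  by (simp add: a_minus_def additive_subgroup.a_closed additive_subgroup.a_inv_closed ideal.axioms(1))

lemma ideal_zero: "ideal I R \<Longrightarrow> \<zero> \<in> I"
  by (simp add: additive_subgroup.zero_closed ideal.axioms(1))

lemma ideal_add_cancel_left:
  assumes "ideal I R" "a \<oplus> b \<in> I" "a \<in> I" "b \<in> carrier R"
  shows "b \<in> I"
proof -
  have a: "a \<in> carrier R" using assms ideal.Icarr by metis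
  have "(a \<oplus> b) \<ominus> a \<in> I" using ideal_minus assms by blast
  moreover have "(a \<oplus> b) \<ominus> a = b" using a assms(4) by algebra
  ultimately show ?thesis by simp
qed

lemma ideal_minus_cancel:
  assumes "ideal I R" "a \<ominus> b \<in> I" "b \<in> I" "a \<in> carrier R"
  shows "a \<in> I"
proof -
  have b: "b \<in> carrier R" using assms ideal.Icarr by metis
  have "(a \<ominus> b) \<oplus> b \<in> I" using ideal_add assms by blast
  moreover have "(a \<ominus> b) \<oplus> b = a" using b assms(4) by algebra
  ultimately show ?thesis by simp
qed

lemma idealI_elems:
  assumes "I \<subseteq> carrier R" "\<zero> \<in> I" "\<And>a b. \<lbrakk>a \<in> I; b \<in> I\<rbrakk> \<Longrightarrow> a \<oplus> b \<in> I"
    "\<And>a r. \<lbrakk>a \<in> I; r \<in> carrier R\<rbrakk> \<Longrightarrow> r \<otimes> a \<in> I"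
    "\<And>a r. \<lbrakk>a \<in> I; r \<in> carrier R\<rbrakk> \<Longrightarrow> a \<otimes> r \<in> I"
  shows "ideal I R"
proof (rule idealI[OF ring_axioms _ assms(4,5)])
  show "subgroup I (add_monoid R)"
  proof (rule add.subgroupI)
    fix a assume a: "a \<in> I"
    have "\<ominus> \<one> \<otimes> a \<in> I" using a assms(4) by simp
    moreover have "\<ominus> \<one> \<otimes> a = \<ominus> a" using a assms(1) by (simp add: l_minus subsetD)
    ultimately show "\<ominus> a \<in> I" by simp
  qed (use assms in auto)
qed

text \<open>An explicit sum \<open>I + R x\<close> rather than a generated ideal, so that membership
  hands over a decomposition \<open>i \<oplus> u \<otimes> x\<close>.\<close>

definition adjoin :: "'a set \<Rightarrow> 'a \<Rightarrow> 'a set"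
  where "adjoin I x = I <+> PIdl x"

lemma mem_adjoin_iff: "r \<in> adjoin I x \<longleftrightarrow> (\<exists>i\<in>I. \<exists>u\<in>carrier R. r = i \<oplus> u \<otimes> x)"
  unfolding adjoin_def set_add_def' cgenideal_def by blast

text \<open>For an ideal \<open>I\<close>, the annihilator of the class of \<open>w\<close> in
  \<open>R/I\<close>, formed inside \<open>R\<close>.\<close>

definition colon :: "'a set \<Rightarrow> 'a \<Rightarrow> 'a set"
  where "colon I w = {r \<in> carrier R. w \<otimes> r \<in> I}"

definition mult_closed :: "'a set \<Rightarrow> bool"
  where "mult_closed T \<longleftrightarrow> T \<subseteq> carrier R \<and> \<one> \<in> T \<and> (\<forall>s\<in>T. \<forall>t\<in>T. s \<otimes> t \<in> T)"

text \<open>For an ideal \<open>I\<close> and multiplicatively closed \<open>T\<close>, the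
  contraction to \<open>R\<close> of the extension of \<open>I\<close> to the ring of fractions with
  denominators in \<open>T\<close>; the ideals with \<open>saturated T I\<close> are exactly such
  contractions.\<close>

definition saturation :: "'a set \<Rightarrow> 'a set \<Rightarrow> 'a set"
  where "saturation T I = {r \<in> carrier R. \<exists>t\<in>T. t \<otimes> r \<in> I}"

definition saturated :: "'a set \<Rightarrow> 'a set \<Rightarrow> bool"
  where "saturated T I \<longleftrightarrow> (\<forall>t\<in>T. \<forall>r\<in>carrier R. t \<otimes> r \<in> I \<longrightarrow> r \<in> I)"

end

context cring
begin

lemma ideal_adjoin: "\<lbrakk>ideal I R; x \<in> carrier R\<rbrakk> \<Longrightarrow> ideal (adjoin I x) R"
  unfolding adjoin_def by (rule add_ideals[OF _ cgenideal_ideal])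

lemma subset_adjoin:
  assumes "ideal I R" "x \<in> carrier R"
  shows "I \<subseteq> adjoin I x"
proof
  fix i assume i: "i \<in> I"
  then have "i = i \<oplus> \<zero> \<otimes> x" using assms ideal.Icarr[OF assms(1)] by simp
  then show "i \<in> adjoin I x" unfolding mem_adjoin_iff using i by blast
qed

lemma self_in_adjoin:
  assumes "ideal I R" "x \<in> carrier R"
  shows "x \<in> adjoin I x"
proof -
  have "x = \<zero> \<oplus> \<one> \<otimes> x" using assms by simp
  then show ?thesis unfolding mem_adjoin_iff using ideal_zero[OF assms(1)] by blast
qed

lemma adjoin_subset:
  assumes "ideal K R" "I \<subseteq> K" "x \<in> K"
  shows "adjoin I x \<subseteq> K"
proof
  fix r assume "r \<in> adjoin I x"
  then obtain i u where "i \<in> I" "u \<in> carrier R" "r = i \<oplus> u \<otimes> x" unfolding mem_adjoin_iff by blast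
  then show "r \<in> K" using assms by (simp add: ideal_add ideal.I_l_closed subsetD)
qed

lemma adjoin_mono: "I \<subseteq> I' \<Longrightarrow> adjoin I x \<subseteq> adjoin I' x"
  unfolding mem_adjoin_iff subset_iff by blast

lemma adjoin_commute:
  assumes "ideal I R" "x \<in> carrier R" "y \<in> carrier R"
  shows "adjoin (adjoin I x) y = adjoin (adjoin I y) x"
proof -
  have "adjoin (adjoin I x) y \<subseteq> adjoin (adjoin I y) x"
    if "x \<in> carrier R" "y \<in> carrier R" for x y
    using that assms(1)
    by (meson adjoin_subset ideal_adjoin self_in_adjoin subset_adjoin subset_iff)
  then show ?thesis using assms by blast
qed

lemma adjoin_genideal:
  assumes "S \<subseteq> carrier R" "x \<in> carrier R"
  shows "adjoin (Idl S) x = Idl (insert x S)"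
proof
  have 1: "ideal (Idl (insert x S)) R" "ideal (Idl S) R" using assms by (simp_all add: genideal_ideal)
  have 2: "insert x S \<subseteq> Idl (insert x S)" by (rule genideal_self) (use assms in auto)
  then have "Idl S \<subseteq> Idl (insert x S)" using 1 by (simp add: genideal_minimal)
  then show "adjoin (Idl S) x \<subseteq> Idl (insert x S)" using adjoin_subset 1 2 by blast
  have "insert x S \<subseteq> adjoin (Idl S) x"
    using subset_adjoin[OF 1(2) assms(2)] self_in_adjoin[OF 1(2) assms(2)] genideal_self[OF assms(1)]
    by blast
  then show "Idl (insert x S) \<subseteq> adjoin (Idl S) x"
    using genideal_minimal ideal_adjoin 1 assms by blast
qed

lemma ideal_colon: "\<lbrakk>ideal I R; w \<in> carrier R\<rbrakk> \<Longrightarrow> ideal (colon I w) R"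
  unfolding colon_def by (rule ideal.helper_max_prime[OF _ is_cring])

lemma subset_colon: "\<lbrakk>ideal I R; w \<in> carrier R\<rbrakk> \<Longrightarrow> I \<subseteq> colon I w"
  by (auto simp: colon_def ideal.Icarr ideal.I_l_closed)

lemma colon_mult_mono: "\<lbrakk>ideal I R; w \<in> carrier R; a \<in> carrier R\<rbrakk> \<Longrightarrow> colon I w \<subseteq> colon I (a \<otimes> w)"
  by (auto simp: colon_def m_assoc ideal.I_l_closed)

lemma ideal_saturation:
  assumes T: "mult_closed T" and I: "ideal I R"
  shows "ideal (saturation T I) R"
proof (rule idealI_elems)
  have T': "T \<subseteq> carrier R" "\<one> \<in> T" using T by (auto simp: mult_closed_def)
  have "\<one> \<otimes> \<zero> \<in> I" using ideal_zero[OF I] by simp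
  then show "\<zero> \<in> saturation T I" using T'(2) unfolding saturation_def by blast
  fix a assume "a \<in> saturation T I"
  then obtain s where a: "a \<in> carrier R" and s: "s \<in> T" "s \<otimes> a \<in> I" by (auto simp: saturation_def)
  have sc: "s \<in> carrier R" using s T' by blast
  show "r \<otimes> a \<in> saturation T I" if r: "r \<in> carrier R" for r
  proof -
    have "s \<otimes> (r \<otimes> a) = r \<otimes> (s \<otimes> a)" using a sc r by algebra
    then have "s \<otimes> (r \<otimes> a) \<in> I" using ideal.I_l_closed[OF I s(2) r] by simp
    then show ?thesis using a r s(1) m_closed unfolding saturation_def by blast
  qed
  then show "a \<otimes> r \<in> saturation T I" if r: "r \<in> carrier R" for r
    using that a m_comm by metis
  fix b assume "b \<in> saturation T I"
  then obtain t where b: "b \<in> carrier R" and t: "t \<in> T" "t \<otimes> b \<in> I" by (auto simp: saturation_def)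
  have tc: "t \<in> carrier R" using t T' by blast
  have "t \<otimes> (s \<otimes> a) \<oplus> s \<otimes> (t \<otimes> b) \<in> I"
    using s t sc tc I by (simp add: ideal_add ideal.I_l_closed)
  moreover have "t \<otimes> (s \<otimes> a) \<oplus> s \<otimes> (t \<otimes> b) = (s \<otimes> t) \<otimes> (a \<oplus> b)" using a b sc tc by algebra
  moreover have "s \<otimes> t \<in> T" using s t T by (auto simp: mult_closed_def)
  ultimately show "a \<oplus> b \<in> saturation T I" using a b by (auto simp: saturation_def)
qed (auto simp: saturation_def)

lemma subset_saturation:
  assumes "mult_closed T" "ideal I R"
  shows "I \<subseteq> saturation T I"
proof
  fix i assume i: "i \<in> I"
  then have "i \<in> carrier R" "\<one> \<otimes> i \<in> I" using ideal.Icarr[OF assms(2)] by simp_all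
  then show "i \<in> saturation T I" using assms(1) unfolding saturation_def mult_closed_def by blast
qed

lemma saturation_mono: "I \<subseteq> I' \<Longrightarrow> saturation T I \<subseteq> saturation T I'"
  by (auto simp: saturation_def)

lemma saturated_saturation:
  assumes T: "mult_closed T" and "S \<subseteq> T"
  shows "saturated S (saturation T I)"
  unfolding saturated_def
proof (intro ballI impI)
  fix t r assume t: "t \<in> S" and r: "r \<in> carrier R" and "t \<otimes> r \<in> saturation T I"
  then obtain s where s: "s \<in> T" "s \<otimes> (t \<otimes> r) \<in> I" by (auto simp: saturation_def)
  have "s \<in> carrier R" "t \<in> carrier R" "s \<otimes> t \<in> T" using s t assms by (auto simp: mult_closed_def)
  moreover from this have "s \<otimes> t \<otimes> r = s \<otimes> (t \<otimes> r)" using r m_assoc by blast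
  ultimately have "s \<otimes> t \<otimes> r \<in> I" using s by simp
  then show "r \<in> saturation T I" using \<open>s \<otimes> t \<in> T\<close> r unfolding saturation_def by blast
qed

lemma saturation_subset: "\<lbrakk>saturated T K; I \<subseteq> K\<rbrakk> \<Longrightarrow> saturation T I \<subseteq> K"
  by (auto simp: saturated_def saturation_def)

lemma mult_closed_compl_prime:
  assumes "primeideal P R"
  shows "mult_closed (carrier R - P)"
  using primeideal.I_prime[OF assms] ideal.one_imp_carrier[OF primeideal.axioms(1)[OF assms]]
    primeideal.I_notcarr[OF assms]
  by (auto simp: mult_closed_def)

text \<open>These are the denominators for inverting \<open>x\<close> in addition to
  \<open>T\<close>.\<close>

lemma mult_closed_powers:
  assumes T: "mult_closed T" and x: "x \<in> carrier R"
  shows "mult_closed {t \<otimes> x [^] (n::nat) | t n. t \<in> T}"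
  unfolding mult_closed_def
proof (intro conjI ballI)
  have T': "T \<subseteq> carrier R" "\<one> \<in> T" using T by (auto simp: mult_closed_def)
  show "{t \<otimes> x [^] n |t (n::nat). t \<in> T} \<subseteq> carrier R" using T' x by auto
  have "\<one> = \<one> \<otimes> x [^] (0::nat)" by simp
  then show "\<one> \<in> {t \<otimes> x [^] n |t (n::nat). t \<in> T}" using T' by blast
  fix a b assume "a \<in> {t \<otimes> x [^] n |t (n::nat). t \<in> T}" "b \<in> {t \<otimes> x [^] n |t (n::nat). t \<in> T}"
  then obtain s m t n where st: "s \<in> T" "t \<in> T" "a = s \<otimes> x [^] (m::nat)" "b = t \<otimes> x [^] (n::nat)" by blast
  have "s \<in> carrier R" "t \<in> carrier R" using st T' by auto
  then have "a \<otimes> b = (s \<otimes> t) \<otimes> x [^] (m + n)"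
    unfolding st nat_pow_mult[OF x, symmetric] using x by (simp add: m_ac)
  moreover have "s \<otimes> t \<in> T" using st T by (auto simp: mult_closed_def)
  ultimately show "a \<otimes> b \<in> {t \<otimes> x [^] n |t (n::nat). t \<in> T}" by blast
qed

lemma prime_pow_mem:
  assumes "primeideal P R" "x \<in> carrier R" "x [^] (n::nat) \<in> P"
  shows "x \<in> P"
  using assms(3)
proof (induction n)
  case 0
  then show ?case
    using ideal.one_imp_carrier[OF primeideal.axioms(1)[OF assms(1)]] primeideal.I_notcarr[OF assms(1)] by simp
next
  case (Suc n)
  then show ?case using primeideal.I_prime[OF assms(1), of "x [^] n" x] assms(2) by auto
qed

end

section \<open>Noetherian rings: associated primes, Nakayama's lemma and the principal ideal
  theorem\<close>

context noetherian_cring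
begin

text \<open>Zorn's lemma applies because in a Noetherian ring the union of a nonempty chain of
  ideals is itself a member of the chain.\<close>

lemma exists_maximal_ideal_in:
  assumes "A \<noteq> {}" "\<And>I. I \<in> A \<Longrightarrow> ideal I R"
  obtains M where "M \<in> A" "\<And>I. \<lbrakk>I \<in> A; M \<subseteq> I\<rbrakk> \<Longrightarrow> I = M"
proof -
  have "\<exists>M\<in>A. \<forall>I\<in>A. M \<subseteq> I \<longrightarrow> I = M"
  proof (rule subset_Zorn_nonempty[OF assms(1)])
    fix C assume C: "C \<noteq> {}" "subset.chain A C"
    then have "subset.chain {I. ideal I R} C" using assms(2) by (auto simp: pred_on.chain_def)
    then have "\<Union>C \<in> C" using ideal_chain_is_trivial C by blast
    then show "\<Union>C \<in> A" using C by (auto simp: pred_on.chain_def)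
  qed
  then show thesis using that by blast
qed

lemma noetherian_induct [consumes 1, case_names step]:
  assumes "ideal I R"
    and "\<And>I. \<lbrakk>ideal I R; \<And>K. \<lbrakk>ideal K R; I \<subset> K\<rbrakk> \<Longrightarrow> Q K\<rbrakk> \<Longrightarrow> Q I"
  shows "Q I"
proof (rule ccontr)
  assume "\<not> Q I"
  then obtain M where "M \<in> {K. ideal K R \<and> \<not> Q K}"
    "\<And>I. \<lbrakk>I \<in> {K. ideal K R \<and> \<not> Q K}; M \<subseteq> I\<rbrakk> \<Longrightarrow> I = M"
    using exists_maximal_ideal_in[of "{K. ideal K R \<and> \<not> Q K}"] assms(1) by blast
  then show False using assms(2)[of M] by blast
qed

text \<open>An annihilator that is maximal among those of nonzero classes modulo \<open>J\<close> is
  prime: if \<open>a b w\<close> lies in \<open>J\<close> and \<open>a w\<close> does not, then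
  \<open>(J : a w)\<close> contains \<open>(J : w)\<close>, hence equals it, and \<open>b\<close>
  belongs to it. The maximality is kept in the conclusion for
  \<open>finite_zero_divisor_primes\<close>.\<close>

lemma prime_colon:
  assumes J: "ideal J R" and z: "z \<in> carrier R" "z \<notin> J"
  obtains w where "w \<in> carrier R" "w \<notin> J" "primeideal (colon J w) R" "colon J z \<subseteq> colon J w"
    "\<And>v. \<lbrakk>v \<in> carrier R; v \<notin> J; colon J w \<subseteq> colon J v\<rbrakk> \<Longrightarrow> colon J v = colon J w"
proof -
  let ?A = "{colon J v | v. v \<in> carrier R \<and> v \<notin> J \<and> colon J z \<subseteq> colon J v}"
  obtain M where M: "M \<in> ?A" "\<And>I. \<lbrakk>I \<in> ?A; M \<subseteq> I\<rbrakk> \<Longrightarrow> I = M"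
    by (rule exists_maximal_ideal_in[of ?A]) (use z ideal_colon[OF J] in auto)
  then obtain w where w: "w \<in> carrier R" "w \<notin> J" "colon J z \<subseteq> colon J w" and Mw: "M = colon J w" by blast
  have max: "colon J v = colon J w" if "v \<in> carrier R" "v \<notin> J" "colon J w \<subseteq> colon J v" for v
    using M(2)[of "colon J v"] that w(3) Mw by blast
  have "primeideal (colon J w) R"
  proof (rule primeidealI[OF ideal_colon[OF J w(1)] is_cring])
    have "\<one> \<notin> colon J w" using w by (simp add: colon_def)
    then show "carrier R \<noteq> colon J w" by blast
    fix a b assume ab: "a \<in> carrier R" "b \<in> carrier R" "a \<otimes> b \<in> colon J w"
    show "a \<in> colon J w \<or> b \<in> colon J w"
    proof (cases "a \<otimes> w \<in> J")
      case True
      then show ?thesis using ab w by (simp add: colon_def m_comm)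
    next
      case False
      have "colon J (a \<otimes> w) = colon J w"
        by (rule max) (use False ab w colon_mult_mono[OF J w(1) ab(1)] in auto)
      moreover have "b \<in> colon J (a \<otimes> w)" using ab w by (simp add: colon_def m_ac)
      ultimately show ?thesis by simp
    qed
  qed
  then show thesis using that w max by blast
qed

text \<open>Nakayama's lemma in the localisation at \<open>P\<close>, by maximality instead of
  determinants. Let \<open>C\<close> be maximal among the saturated ideals that contain
  \<open>B\<close> but not \<open>A\<close>, and let \<open>a \<in> A\<close> lie outside
  \<open>C\<close>. The saturation of \<open>C + R a\<close> contains \<open>A\<close>, so the given
  \<open>a'\<close> can be rewritten through \<open>a\<close>, which puts a multiple of
  \<open>a\<close> by an element outside \<open>P\<close> into \<open>C\<close>.\<close>

lemma nakayama:
  assumes P: "primeideal P R" and A: "ideal A R" and B: "ideal B R" "saturated (carrier R - P) B"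
    and x: "x \<in> P"
    and AB: "\<And>a. a \<in> A \<Longrightarrow> \<exists>s\<in>carrier R - P. \<exists>b\<in>B. \<exists>a'\<in>A. s \<otimes> a = b \<oplus> x \<otimes> a'"
  shows "A \<subseteq> B"
proof (rule ccontr)
  let ?T = "carrier R - P"
  assume "\<not> A \<subseteq> B"
  have T: "mult_closed ?T" by (rule mult_closed_compl_prime[OF P])
  have iP: "ideal P R" using P by (rule primeideal.axioms)
  let ?S = "{C. ideal C R \<and> saturated ?T C \<and> B \<subseteq> C \<and> \<not> A \<subseteq> C}"
  obtain C where C: "C \<in> ?S" and max: "\<And>I. \<lbrakk>I \<in> ?S; C \<subseteq> I\<rbrakk> \<Longrightarrow> I = C"
    by (rule exists_maximal_ideal_in[of ?S]) (use B \<open>\<not> A \<subseteq> B\<close> in auto)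
  then obtain a where a: "a \<in> A" "a \<notin> C" by blast
  have iC: "ideal C R" using C by blast
  have ac: "a \<in> carrier R" using a A ideal.Icarr by metis
  have xc: "x \<in> carrier R" using x iP ideal.Icarr by metis
  define D where "D = saturation ?T (adjoin C a)"
  have iD: "ideal D R" unfolding D_def using T ideal_adjoin iC ac ideal_saturation by blast
  have sub: "adjoin C a \<subseteq> D" unfolding D_def using T ideal_adjoin iC ac subset_saturation by blast
  then have CD: "C \<subseteq> D" "a \<in> D" using subset_adjoin self_in_adjoin iC ac by blast+
  moreover have "saturated ?T D" unfolding D_def using saturated_saturation[OF T] by blast
  ultimately have "A \<subseteq> D" using max[of D] iD C a by blast
  obtain s b a' where s: "s \<in> ?T" "b \<in> B" "a' \<in> A" "s \<otimes> a = b \<oplus> x \<otimes> a'" using AB a by blast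
  then have "a' \<in> D" using \<open>A \<subseteq> D\<close> by blast
  then obtain t c r where t: "t \<in> ?T" "c \<in> C" "r \<in> carrier R" "t \<otimes> a' = c \<oplus> r \<otimes> a"
    unfolding D_def saturation_def mem_adjoin_iff by blast
  have carr: "s \<in> carrier R" "t \<in> carrier R" "b \<in> carrier R" "c \<in> carrier R" "a' \<in> carrier R" "b \<in> C"
    using s(1) t(1) ideal.Icarr[OF B(1) s(2)] ideal.Icarr[OF iC t(2)] ideal.Icarr[OF A s(3)] s(2) C
    by blast+
  \<comment> \<open>The coefficient of \<open>a\<close> is outside \<open>P\<close>, because
    \<open>s \<otimes> t\<close> is and \<open>x \<otimes> r\<close> is in \<open>P\<close>;
    \<open>C\<close> being saturated, it can be cancelled.\<close>
  have "(s \<otimes> t \<ominus> x \<otimes> r) \<otimes> a = t \<otimes> (s \<otimes> a) \<ominus> x \<otimes> (r \<otimes> a)" using carr ac xc t by algebra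
  also have "\<dots> = t \<otimes> b \<oplus> x \<otimes> (t \<otimes> a') \<ominus> x \<otimes> (r \<otimes> a)" unfolding s(4) using carr ac xc t(3) by algebra
  also have "\<dots> = t \<otimes> b \<oplus> x \<otimes> c" unfolding t(4) using carr ac xc t(3) by algebra
  also have "\<dots> \<in> C" using carr t xc iC by (simp add: ideal_add ideal.I_l_closed)
  finally have 1: "(s \<otimes> t \<ominus> x \<otimes> r) \<otimes> a \<in> C" .
  have "s \<otimes> t \<notin> P" using T s t by (auto simp: mult_closed_def)
  moreover have "x \<otimes> r \<in> P" using x t iP by (simp add: ideal.I_r_closed)
  ultimately have "s \<otimes> t \<ominus> x \<otimes> r \<in> ?T"
    using ideal_minus_cancel[OF iP, of "s \<otimes> t" "x \<otimes> r"] carr xc t by auto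
  then show False using 1 C a ac by (auto simp: saturated_def)
qed

text \<open>The Artinian property of a Noetherian local ring with a single prime ideal, by Noetherian
  induction: if \<open>(I : w) = P\<close>, there is no saturated ideal strictly between \<open>I\<close> and
  the saturation of \<open>I + R w\<close>.\<close>

lemma saturated_dcc:
  assumes P: "primeideal P R" and "ideal I R" and "saturated (carrier R - P) I"
    and min: "\<And>Q. \<lbrakk>primeideal Q R; I \<subseteq> Q; Q \<subseteq> P\<rbrakk> \<Longrightarrow> Q = P"
    and C: "\<And>n. ideal (C n) R" "\<And>n. saturated (carrier R - P) (C n)" "\<And>n. I \<subseteq> C n" "decseq C"
  shows "\<exists>N. \<forall>n\<ge>N. C n = C N"
  using assms(2,3) min C
proof (induction I arbitrary: C rule: noetherian_induct)
  case (step I)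
  let ?T = "carrier R - P"
  have T: "mult_closed ?T" by (rule mult_closed_compl_prime[OF P])
  note iI = step.hyps
  note C = step.prems(3-6)
  show ?case
  proof (cases "\<one> \<in> I")
    case True
    then have "C n = carrier R" for n using C(1,3) ideal.one_imp_carrier by blast
    then show ?thesis by simp
  next
    case False
    then obtain w where w: "w \<in> carrier R" "w \<notin> I" "primeideal (colon I w) R"
      using prime_colon[OF iI one_closed] by metis
    \<comment> \<open>Saturation puts the associated prime \<open>(I : w)\<close> inside
      \<open>P\<close>; minimality of \<open>P\<close> over \<open>I\<close> then makes the two
      equal.\<close>
    have "colon I w \<subseteq> P"
    proof
      fix r assume "r \<in> colon I w"
      then have "r \<in> carrier R" "r \<otimes> w \<in> I" using w m_comm[of w r] by (simp_all add: colon_def)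
      then show "r \<in> P" using step.prems(1) w unfolding saturated_def by blast
    qed
    then have wP: "colon I w = P" using step.prems(2) w subset_colon[OF iI] by blast
    define I' where "I' = saturation ?T (adjoin I w)"
    have iI': "ideal I' R" "saturated ?T I'"
      unfolding I'_def using T ideal_adjoin iI w ideal_saturation saturated_saturation by blast+
    have sub: "adjoin I w \<subseteq> I'" unfolding I'_def using T ideal_adjoin iI w subset_saturation by blast
    then have I': "I \<subset> I'" using subset_adjoin self_in_adjoin iI w by blast
    note IH = step.IH[OF iI'(1) I' iI'(2)]
    have min': "Q = P" if "primeideal Q R" "I' \<subseteq> Q" "Q \<subseteq> P" for Q
      using step.prems(2) that I' by blast
    \<comment> \<open>If every \<open>C n\<close> contains \<open>w\<close>, the chain already lies
      above \<open>I'\<close>. Otherwise the enlarged chain \<open>C'\<close> is stationary by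
      induction, and \<open>C\<close> is recovered from it.\<close>
    show ?thesis
    proof (cases "\<forall>n. w \<in> C n")
      case True
      then have "I' \<subseteq> C n" for n
        unfolding I'_def using C adjoin_subset saturation_subset by metis
      then show ?thesis using IH[of C] min' C by blast
    next
      case False
      then obtain N0 where N0: "w \<notin> C N0" by blast
      define C' where "C' n = saturation ?T (adjoin (C n) w)" for n
      have "ideal (C' n) R" "saturated ?T (C' n)" for n
        unfolding C'_def using T ideal_adjoin C w ideal_saturation saturated_saturation by blast+
      moreover have "I' \<subseteq> C' n" for n
        unfolding C'_def I'_def using C adjoin_mono saturation_mono by metis
      moreover have "decseq C'"
        using C(4) unfolding C'_def decseq_def by (simp add: adjoin_mono saturation_mono)
      ultimately obtain N1 where N1: "\<And>n. n \<ge> N1 \<Longrightarrow> C' n = C' N1" using IH[of C'] min' by blast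
      define N where "N = max N0 N1"
      have "C n = C N" if n: "n \<ge> N" for n
      proof
        show "C n \<subseteq> C N" using C(4) n by (auto simp: decseq_def)
        show "C N \<subseteq> C n"
        proof
          fix r assume r: "r \<in> C N"
          then have rc: "r \<in> carrier R" using C ideal.Icarr by metis
          have "r \<in> adjoin (C N) w" using r subset_adjoin C w by blast
          then have "r \<in> C' N" unfolding C'_def using subset_saturation[OF T] ideal_adjoin C w by blast
          then have "r \<in> C' n" using N1[of n] N1[of N] n by (simp add: N_def)
          then obtain s c u where s: "s \<in> ?T" "c \<in> C n" "u \<in> carrier R" "s \<otimes> r = c \<oplus> u \<otimes> w"
            unfolding C'_def saturation_def mem_adjoin_iff by blast
          \<comment> \<open>Since \<open>w\<close> is outside the saturated ideal
            \<open>C N\<close>, \<open>u \<otimes> w \<in> C N\<close> forces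
            \<open>u \<in> P = (I : w)\<close>, so \<open>u \<otimes> w\<close> lies in
            \<open>I\<close> and hence in \<open>C n\<close>.\<close>
          have "c \<in> C N" using s(2) \<open>C n \<subseteq> C N\<close> by blast
          moreover have "s \<otimes> r \<in> C N" using ideal.I_l_closed[OF C(1) r] s(1) by blast
          ultimately have "u \<otimes> w \<in> C N" using ideal_add_cancel_left[OF C(1)] s w by simp
          moreover have "w \<notin> C N" using N0 decseqD[OF C(4), of N0 N] by (auto simp: N_def)
          ultimately have "u \<in> P" using C(2)[of N] s w by (auto simp: saturated_def)
          then have "u \<otimes> w \<in> I" using wP w by (auto simp: colon_def m_comm)
          then have "s \<otimes> r \<in> C n" unfolding s(4) using s(2) C(3) ideal_add[OF C(1)] by blast
          then show "r \<in> C n" using C(2)[of n] s rc by (auto simp: saturated_def)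
        qed
      qed
      then show ?thesis by blast
    qed
  qed
qed

text \<open>For a nonzero \<open>y \<in> Q/Q0\<close>, the contractions \<open>J n\<close> of the ideals generated by \<open>y\<^sup>n\<close> in the
  localisation at \<open>P\<close> with \<open>x\<close> inverted are stationary modulo \<open>x\<close>, hence stationary by Nakayama, so that
  \<open>y\<close> becomes a unit there.\<close>

lemma principal_ideal_theorem:
  assumes Q0: "primeideal Q0 R" and Q: "primeideal Q R" and P: "primeideal P R"
    and lt: "Q0 \<subset> Q" "Q \<subset> P" and x: "x \<in> P"
  obtains P' where "primeideal P' R" "Q0 \<subseteq> P'" "x \<in> P'" "P' \<subset> P"
proof (rule ccontr)
  note contra = that
  assume "\<not> thesis"
  \<comment> \<open>The negated conclusion says that \<open>P\<close> is the only prime inside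
    \<open>P\<close> that contains \<open>Q0\<close> and \<open>x\<close>.\<close>
  then have min: "P' = P" if "primeideal P' R" "Q0 \<subseteq> P'" "x \<in> P'" "P' \<subseteq> P" for P'
    using that contra by blast
  have iQ0: "ideal Q0 R" and iQ: "ideal Q R" and iP: "ideal P R"
    using Q0 Q P by (auto intro: primeideal.axioms)
  have xQ: "x \<notin> Q" using min[OF Q] lt by blast
  obtain y where y: "y \<in> Q" "y \<notin> Q0" using lt by blast
  have xc: "x \<in> carrier R" and yc: "y \<in> carrier R" using x y iP iQ ideal.Icarr by metis+
  let ?S = "carrier R - P"
  \<comment> \<open>Denominators for inverting \<open>x\<close> in the localisation at
    \<open>P\<close>. Since \<open>x \<notin> Q\<close>, the prime \<open>Q\<close> avoids them and
    survives there.\<close>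
  define T where "T = {s \<otimes> x [^] (k::nat) | s k. s \<in> ?S}"
  have S: "mult_closed ?S" by (rule mult_closed_compl_prime[OF P])
  have T: "mult_closed T" unfolding T_def by (rule mult_closed_powers[OF S xc])
  have ST: "?S \<subseteq> T"
  proof
    fix s assume "s \<in> ?S"
    moreover from this have "s = s \<otimes> x [^] (0::nat)" by simp
    ultimately show "s \<in> T" unfolding T_def by blast
  qed
  have xT: "x \<in> T"
  proof -
    have "x = \<one> \<otimes> x [^] (1::nat)" using xc by simp
    then show ?thesis using S unfolding T_def mult_closed_def by blast
  qed
  have TQ: "t \<notin> Q" if "t \<in> T" for t
  proof
    assume "t \<in> Q"
    obtain s k where s: "s \<in> ?S" "t = s \<otimes> x [^] (k::nat)" using \<open>t \<in> T\<close> T_def by blast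
    then have "s \<in> Q \<or> x [^] k \<in> Q" using primeideal.I_prime[OF Q] xc \<open>t \<in> Q\<close> by auto
    then show False using s lt prime_pow_mem[OF Q xc] xQ by blast
  qed
  define J where "J n = saturation T (adjoin Q0 (y [^] (n::nat)))" for n
  define C where "C n = saturation ?S (adjoin (J n) x)" for n
  have J: "ideal (J n) R" "saturated T (J n)" for n
    unfolding J_def using T ideal_adjoin iQ0 yc ideal_saturation saturated_saturation by auto
  have JQ0: "Q0 \<subseteq> J n" and Jy: "y [^] n \<in> J n" for n
    unfolding J_def
    using subset_saturation[OF T ideal_adjoin[OF iQ0]] subset_adjoin[OF iQ0] self_in_adjoin[OF iQ0] yc
    by (meson nat_pow_closed subsetD subsetI)+
  have "J (Suc n) \<subseteq> J n" for n
  proof -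
    have "y [^] Suc n \<in> J n" using ideal.I_r_closed[OF J(1) Jy yc] by simp
    then show ?thesis
      unfolding J_def[of "Suc n"] using adjoin_subset[OF J(1) JQ0] saturation_subset[OF J(2)] by blast
  qed
  then have "decseq J" by (rule decseq_SucI)
  have C: "ideal (C n) R" "saturated ?S (C n)" for n
    unfolding C_def using S ideal_adjoin J xc ideal_saturation saturated_saturation by auto
  have "\<exists>N. \<forall>n\<ge>N. C n = C N"
  proof (rule saturated_dcc[OF P, of "saturation ?S (adjoin Q0 x)"])
    show "ideal (saturation ?S (adjoin Q0 x)) R" "saturated ?S (saturation ?S (adjoin Q0 x))"
      using S ideal_adjoin iQ0 xc ideal_saturation saturated_saturation by auto
    show "saturation ?S (adjoin Q0 x) \<subseteq> C n" for n
      unfolding C_def by (intro saturation_mono adjoin_mono JQ0)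
    show "decseq C" using \<open>decseq J\<close> unfolding C_def decseq_def by (simp add: adjoin_mono saturation_mono)
    fix P' assume P': "primeideal P' R" "saturation ?S (adjoin Q0 x) \<subseteq> P'" "P' \<subseteq> P"
    have "adjoin Q0 x \<subseteq> P'" using P'(2) subset_saturation[OF S ideal_adjoin[OF iQ0 xc]] by blast
    then show "P' = P"
      using min P' subset_adjoin[OF iQ0 xc] self_in_adjoin[OF iQ0 xc] by blast
  qed (use C in auto)
  then obtain N where N: "C (Suc N) = C N" by (metis le_SucI order_refl)
  \<comment> \<open>By \<open>C (Suc N) = C N\<close>, an element of \<open>J N\<close> lies in
    \<open>J (Suc N) + R x\<close> up to a factor outside \<open>P\<close>. The coefficient of
    \<open>x\<close> is again in \<open>J N\<close>, because \<open>x \<in> T\<close> and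
    \<open>J N\<close> is saturated for \<open>T\<close>; this is the hypothesis of Nakayama's
    lemma.\<close>
  have "J N \<subseteq> J (Suc N)"
  proof (rule nakayama[OF P J(1) J(1) _ x])
    show "saturated ?S (J (Suc N))" using J(2)[of "Suc N"] ST by (auto simp: saturated_def)
    fix r assume r: "r \<in> J N"
    have "r \<in> C N" unfolding C_def
      using r subset_adjoin[OF J(1) xc] subset_saturation[OF S ideal_adjoin[OF J(1) xc]] by blast
    then have "r \<in> C (Suc N)" by (simp add: N)
    then obtain s j u where s: "s \<in> ?S" "j \<in> J (Suc N)" "u \<in> carrier R" "s \<otimes> r = j \<oplus> u \<otimes> x"
      unfolding C_def saturation_def mem_adjoin_iff by blast
    have "s \<otimes> r \<in> J N" using ideal.I_l_closed[OF J(1) r] s(1) by blast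
    moreover have "j \<in> J N" using s(2) decseqD[OF \<open>decseq J\<close>, of N "Suc N"] by auto
    ultimately have "u \<otimes> x \<in> J N" using ideal_add_cancel_left[OF J(1)] s xc by simp
    then have "u \<in> J N" using J(2) xT s xc by (auto simp: saturated_def m_comm)
    then show "\<exists>s\<in>?S. \<exists>b\<in>J (Suc N). \<exists>a'\<in>J N. s \<otimes> r = b \<oplus> x \<otimes> a'"
      using s xc by (metis m_comm)
  qed
  then have "y [^] N \<in> J (Suc N)" using Jy by blast
  then obtain t q u where t: "t \<in> T" "q \<in> Q0" "u \<in> carrier R" "t \<otimes> y [^] N = q \<oplus> u \<otimes> y [^] Suc N"
    unfolding J_def saturation_def mem_adjoin_iff by blast
  have carr: "t \<in> carrier R" "q \<in> carrier R" 
    using t(1) T ideal.Icarr[OF iQ0 t(2)] by (auto simp: mult_closed_def)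
  have yN: "y [^] N \<in> carrier R" using yc by simp
  \<comment> \<open>Cancelling \<open>y [^] N\<close> modulo the prime \<open>Q0\<close> leaves
    \<open>t \<ominus> u \<otimes> y \<in> Q0\<close>, so \<open>t \<in> Q\<close> although
    \<open>t \<in> T\<close>.\<close>
  have "y [^] N \<otimes> (t \<ominus> u \<otimes> y) = t \<otimes> y [^] N \<ominus> u \<otimes> (y [^] N \<otimes> y)"
    using carr t(3) yc yN by algebra
  also have "\<dots> = q" unfolding t(4) nat_pow_Suc using carr t(3) yc yN by algebra
  finally have "y [^] N \<otimes> (t \<ominus> u \<otimes> y) \<in> Q0" using t by simp
  then have "y [^] N \<in> Q0 \<or> t \<ominus> u \<otimes> y \<in> Q0"
    using primeideal.I_prime[OF Q0] carr yc yN t(3) by simp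
  then have "t \<ominus> u \<otimes> y \<in> Q" using prime_pow_mem[OF Q0 yc] y lt by blast
  then have "t \<in> Q" using ideal_minus_cancel[OF iQ, of t "u \<otimes> y"] iQ y t(3) carr by (simp add: ideal.I_l_closed)
  then show False using TQ t by blast
qed

end

section \<open>Prime chains and the height theorem\<close>

text \<open>For an ideal \<open>I\<close>, such chains stand for the chains of primes of
  \<open>R/I\<close>; \<open>n\<close> counts the inclusions, so \<open>n + 1\<close> primes
  occur.\<close>

definition has_prime_chain :: "('a, 'b) ring_scheme \<Rightarrow> 'a set \<Rightarrow> nat \<Rightarrow> bool"
  where "has_prime_chain R I n \<longleftrightarrow>
    (\<exists>P. (\<forall>i\<le>n. primeideal (P i) R \<and> I \<subseteq> P i) \<and> (\<forall>i<n. P i \<subset> P (Suc i)))"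

text \<open>\<open>K\<close> may be any set strictly above \<open>P\<close>, so that a chain over
  \<open>P + R x\<close> can be prolonged downwards by \<open>P\<close>.\<close>

lemma has_prime_chain_Cons:
  assumes "has_prime_chain R K n" "primeideal P R" "I \<subseteq> P" "P \<subset> K"
  shows "has_prime_chain R I (Suc n)"
proof -
  obtain C where C: "\<forall>i\<le>n. primeideal (C i) R \<and> K \<subseteq> C i" "\<forall>i<n. C i \<subset> C (Suc i)"
    using assms(1) unfolding has_prime_chain_def by blast
  define D where "D i = (case i of 0 \<Rightarrow> P | Suc i \<Rightarrow> C i)" for i
  have "primeideal (D i) R \<and> I \<subseteq> D i" if "i \<le> Suc n" for i
  proof (cases i)
    case (Suc k)
    then have "primeideal (C k) R \<and> K \<subseteq> C k" using that C(1) by simp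
    then show ?thesis using Suc assms(3,4) by (auto simp: D_def)
  qed (use assms(2,3) in \<open>simp add: D_def\<close>)
  moreover have "D i \<subset> D (Suc i)" if "i < Suc n" for i
  proof (cases i)
    case 0
    have "K \<subseteq> C 0" using C(1) by simp
    then show ?thesis using 0 assms(4) by (auto simp: D_def)
  qed (use that C(2) in \<open>simp add: D_def\<close>)
  ultimately show ?thesis unfolding has_prime_chain_def by blast
qed

lemma has_prime_chain_SucD: "has_prime_chain R I (Suc n) \<Longrightarrow> has_prime_chain R I n"
  unfolding has_prime_chain_def by (meson le_SucI less_SucI)

section \<open>Prime avoidance and regular sequences modulo an ideal\<close>

context cring
begin

text \<open>Multiply together one element outside \<open>P\<close> from each ideal; the product
  stays outside \<open>P\<close>.\<close>

lemma exists_in_ideals_not_in_prime: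
  assumes "finite F" "primeideal P R" "\<And>I. I \<in> F \<Longrightarrow> ideal I R \<and> \<not> I \<subseteq> P"
  shows "\<exists>t\<in>carrier R - P. \<forall>I\<in>F. t \<in> I"
  using assms(1,3)
proof (induction F rule: finite_induct)
  case empty
  show ?case using mult_closed_compl_prime[OF assms(2)] by (auto simp: mult_closed_def)
next
  case (insert I F)
  then obtain t where t: "t \<in> carrier R - P" "\<forall>I\<in>F. t \<in> I" by auto
  obtain u where u: "u \<in> I" "u \<notin> P" using insert.prems[of I] by blast
  then have uc: "u \<in> carrier R" using insert.prems[of I] ideal.Icarr[of I R u] by simp
  have "t \<otimes> u \<in> carrier R - P"
    using mult_closed_compl_prime[OF assms(2)] t u uc by (auto simp: mult_closed_def)
  moreover have "t \<otimes> u \<in> I'" if "I' \<in> insert I F" for I'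
    using that t u uc insert.prems by (auto intro: ideal.I_l_closed ideal.I_r_closed)
  ultimately show ?case by blast
qed

text \<open>Induction on the family. A prime contained in another one may be dropped. Otherwise some
  \<open>P\<close> contains no other member; if an \<open>x \<in> I\<close> avoiding the others lies
  in \<open>P\<close>, add to it an element of \<open>I\<close> that lies in all the others but not
  in \<open>P\<close>.\<close>

lemma prime_avoidance:
  assumes "finite F" "ideal I R" "\<And>P. P \<in> F \<Longrightarrow> primeideal P R \<and> \<not> I \<subseteq> P"
  shows "\<exists>x\<in>I. \<forall>P\<in>F. x \<notin> P"
  using assms(1,3)
proof (induction F rule: finite_psubset_induct)
  case (psubset F)
  consider "F = {}" | P P' where "P \<in> F" "P' \<in> F" "P \<noteq> P'" "P' \<subseteq> P"
    | P where "P \<in> F" "\<And>P'. P' \<in> F - {P} \<Longrightarrow> \<not> P' \<subseteq> P"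
    by blast
  then show ?case
  proof cases
    case 1
    then show ?thesis using ideal_zero[OF assms(2)] by auto
  next
    case 2
    have "F - {P'} \<subset> F" using 2 by blast
    then obtain x where "x \<in> I" "\<forall>Q\<in>F - {P'}. x \<notin> Q"
      using psubset.IH[of "F - {P'}"] psubset.prems by auto
    then show ?thesis using 2 by blast
  next
    case 3
    have "F - {P} \<subset> F" using 3 by blast
    then obtain x where x: "x \<in> I" "\<forall>Q\<in>F - {P}. x \<notin> Q"
      using psubset.IH[of "F - {P}"] psubset.prems by auto
    show ?thesis
    proof (cases "x \<in> P")
      case False
      then show ?thesis using x by blast
    next
      case True
      have pP: "primeideal P R" using psubset.prems 3 by blast
      have "\<exists>t\<in>carrier R - P. \<forall>K\<in>insert I (F - {P}). t \<in> K"
      proof (rule exists_in_ideals_not_in_prime[OF _ pP])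
        show "finite (insert I (F - {P}))" using psubset.hyps by simp
        show "ideal K R \<and> \<not> K \<subseteq> P" if "K \<in> insert I (F - {P})" for K
          using that 3 psubset.prems assms(2) primeideal.axioms(1) by blast
      qed
      then obtain t where t: "t \<notin> P" "t \<in> I" "\<And>Q. Q \<in> F - {P} \<Longrightarrow> t \<in> Q" by blast
      have tc: "t \<in> carrier R" "x \<in> carrier R" using t x ideal.Icarr[OF assms(2)] by simp_all
      have "t \<oplus> x \<notin> Q" if Q: "Q \<in> F" for Q
      proof
        assume 0: "t \<oplus> x \<in> Q"
        have iQ: "ideal Q R" using psubset.prems Q primeideal.axioms(1) by blast
        show False
        proof (cases "Q = P")
          case True
          have "x \<oplus> t \<in> Q" using 0 a_comm tc by simp
          then show False using ideal_add_cancel_left[OF iQ _ _ tc(1)] \<open>x \<in> P\<close> True t(1) by simp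
        next
          case False
          then show False using ideal_add_cancel_left[OF iQ 0 _ tc(2)] x(2) t(3) Q by simp
        qed
      qed
      then show ?thesis using ideal_add[OF assms(2) t(2) x(1)] by blast
    qed
  qed
qed

definition regular_mod :: "'a set \<Rightarrow> 'a \<Rightarrow> bool"
  where "regular_mod J x \<longleftrightarrow> (\<forall>a\<in>carrier R. x \<otimes> a \<in> J \<longrightarrow> a \<in> J)"

text \<open>A weakly regular sequence on \<open>R/J\<close>, in recursive form: the tail is tested
  modulo \<open>J + R x\<close>, which suits inductions that change \<open>J\<close>.\<close>

primrec regular_sequence_mod :: "'a set \<Rightarrow> 'a list \<Rightarrow> bool"
  where "regular_sequence_mod J [] \<longleftrightarrow> True"
  | "regular_sequence_mod J (x # xs) \<longleftrightarrow> regular_mod J x \<and> regular_sequence_mod (adjoin J x) xs"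

lemma regular_modD: "\<lbrakk>regular_mod J x; x \<otimes> a \<in> J; a \<in> carrier R\<rbrakk> \<Longrightarrow> a \<in> J"
  by (simp add: regular_mod_def)

text \<open>Half of the exchange of two consecutive regular elements. If
  \<open>x a = j + b y\<close>, then \<open>y b \<in> J + R x\<close>, so
  \<open>b = i + c x\<close>; now \<open>x (a - c y) = j + i y\<close> lies in \<open>J\<close>, and
  \<open>x\<close> cancels.\<close>

lemma regular_mod_adjoin_swap:
  assumes J: "ideal J R" and x: "x \<in> carrier R" and y: "y \<in> carrier R"
    and rx: "regular_mod J x" and ry: "regular_mod (adjoin J x) y"
  shows "regular_mod (adjoin J y) x"
  unfolding regular_mod_def
proof (intro ballI impI)
  fix a assume a: "a \<in> carrier R" and "x \<otimes> a \<in> adjoin J y"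
  then obtain j b where j: "j \<in> J" "b \<in> carrier R" "x \<otimes> a = j \<oplus> b \<otimes> y"
    unfolding mem_adjoin_iff by blast
  have jc: "j \<in> carrier R" using ideal.Icarr[OF J j(1)] .
  have "y \<otimes> b = x \<otimes> a \<ominus> j" unfolding j(3) using jc j(2) y by algebra
  moreover have "x \<otimes> a \<ominus> j \<in> adjoin J x"
    using ideal_minus[OF ideal_adjoin[OF J x]] ideal.I_r_closed[OF ideal_adjoin[OF J x] self_in_adjoin[OF J x] a]
      subset_adjoin[OF J x] j(1) by blast
  ultimately have "b \<in> adjoin J x" using regular_modD[OF ry _ j(2)] by simp
  then obtain i c where i: "i \<in> J" "c \<in> carrier R" "b = i \<oplus> c \<otimes> x" unfolding mem_adjoin_iff by blast
  have ic: "i \<in> carrier R" using ideal.Icarr[OF J i(1)] .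
  have "x \<otimes> (a \<ominus> c \<otimes> y) = x \<otimes> a \<ominus> c \<otimes> x \<otimes> y" using x y a i(2) by algebra
  also have "\<dots> = j \<oplus> i \<otimes> y" unfolding j(3) i(3) using x y jc ic i(2) by algebra
  also have "\<dots> \<in> J" using ideal_add[OF J j(1) ideal.I_r_closed[OF J i(1) y]] .
  finally have "a \<ominus> c \<otimes> y \<in> J" using regular_modD[OF rx] a y i(2) by simp
  moreover have "a = (a \<ominus> c \<otimes> y) \<oplus> c \<otimes> y" using a y i(2) by algebra
  ultimately show "a \<in> adjoin J y" unfolding mem_adjoin_iff using i(2) by blast
qed

end

section \<open>The height theorem and the primes of zero divisors\<close>

context noetherian_cring
begin

text \<open>Modulo \<open>I\<close>, the localisation at \<open>P\<close> has a single prime, so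
  \<open>z\<close> is nilpotent there. Otherwise \<open>z\<close> could be inverted as well, and an
  associated prime of the resulting saturation would lie between \<open>I\<close> and
  \<open>P\<close> and avoid \<open>z\<close>.\<close>

lemma minimal_prime_power:
  assumes I: "ideal I R" and P: "primeideal P R" and z: "z \<in> P"
    and min: "\<And>Q. \<lbrakk>primeideal Q R; I \<subseteq> Q; Q \<subseteq> P\<rbrakk> \<Longrightarrow> Q = P"
  shows "\<exists>s\<in>carrier R - P. \<exists>n::nat. s \<otimes> z [^] n \<in> I"
proof (rule ccontr)
  assume no: "\<not> ?thesis"
  let ?S = "carrier R - P"
  have zc: "z \<in> carrier R" using ideal.Icarr[OF primeideal.axioms(1)[OF P] z] .
  define T where "T = {s \<otimes> z [^] (n::nat) | s n. s \<in> ?S}"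
  have S: "mult_closed ?S" by (rule mult_closed_compl_prime[OF P])
  have T: "mult_closed T" unfolding T_def by (rule mult_closed_powers[OF S zc])
  define K where "K = saturation T I"
  have K: "ideal K R" "saturated T K" "I \<subseteq> K"
    unfolding K_def using ideal_saturation[OF T I] saturated_saturation[OF T] subset_saturation[OF T I] by auto
  have "\<one> \<notin> K"
  proof
    assume "\<one> \<in> K"
    then obtain t where t: "t \<in> T" "t \<otimes> \<one> \<in> I" by (auto simp: K_def saturation_def)
    then have "t \<in> I" using T by (auto simp: mult_closed_def)
    then show False using no t(1) unfolding T_def by blast
  qed
  then obtain w where w: "w \<in> carrier R" "w \<notin> K" "primeideal (colon K w) R"
    using prime_colon[OF K(1) one_closed] by metis
  have TK: "t \<notin> colon K w" if t: "t \<in> T" for t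
  proof
    assume "t \<in> colon K w"
    then have "t \<otimes> w \<in> K" using w(1) m_comm[of w t] by (simp add: colon_def)
    then show False using K(2) w t by (auto simp: saturated_def)
  qed
  have ST: "s \<in> T" if "s \<in> ?S" for s
  proof -
    have "s = s \<otimes> z [^] (0::nat)" using that by simp
    then show ?thesis unfolding T_def using that by blast
  qed
  have "colon K w \<subseteq> carrier R" by (auto simp: colon_def)
  then have "colon K w \<subseteq> P" using TK ST by blast
  then have "colon K w = P" using min[OF w(3)] subset_colon[OF K(1) w(1)] K(3) by blast
  moreover have "z \<in> T"
  proof -
    have "z = \<one> \<otimes> z [^] (1::nat)" using zc by simp
    then show ?thesis using S unfolding T_def mult_closed_def by blast
  qed
  ultimately show False using TK z by blast
qed

text \<open>Krull's height theorem, by induction on the number of generators. Let \<open>Q\<close>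
  be maximal among the primes strictly inside \<open>P\<close> and above the last but one term of
  the chain, and pick \<open>x \<in> A\<close> outside \<open>Q\<close>. As \<open>P\<close> is
  minimal over \<open>Q + R x\<close>, some power of each \<open>z \<in> A\<close> is, up to a
  factor outside \<open>P\<close>, congruent modulo \<open>x\<close> to some
  \<open>q z \<in> Q\<close>. These elements with \<open>z \<noteq> x\<close> have \<open>Q\<close>
  as a minimal prime: below a smaller one \<open>Q'\<close>, the principal ideal theorem would yield
  a prime strictly inside \<open>P\<close> that contains \<open>Q'\<close> and \<open>x\<close>,
  hence all of \<open>A\<close>.\<close>

lemma height_theorem:
  assumes "finite A" "card A \<le> n" "A \<subseteq> P" "primeideal P R"
    and "\<And>Q. \<lbrakk>primeideal Q R; A \<subseteq> Q; Q \<subseteq> P\<rbrakk> \<Longrightarrow> Q = P"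
    and "\<And>i. i \<le> l \<Longrightarrow> primeideal (C i) R" "\<And>i. i < l \<Longrightarrow> C i \<subset> C (Suc i)" "C l \<subseteq> P"
  shows "l \<le> n"
  using assms
proof (induction n arbitrary: A P l C)
  case 0
  show ?case
  proof (cases l)
    case (Suc k)
    have "C k \<subset> P" using "0.prems"(7)[of k] "0.prems"(8) Suc by blast
    moreover have "A \<subseteq> C k" "primeideal (C k) R" using 0 Suc by auto
    ultimately show ?thesis using "0.prems"(5)[of "C k"] by auto
  qed simp
next
  case (Suc n)
  note A = Suc.prems(1,2,3) and P = Suc.prems(4) and min = Suc.prems(5) and C = Suc.prems(6,7,8)
  show ?case
  proof (cases l)
    case (Suc k)
    let ?S = "{Q. primeideal Q R \<and> C k \<subseteq> Q \<and> Q \<subset> P}"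
    have "C k \<in> ?S" using C(1)[of k] C(2)[of k] C(3) Suc by auto
    moreover have "\<And>I. I \<in> ?S \<Longrightarrow> ideal I R" by (simp add: primeideal.axioms(1))
    ultimately obtain Q where QS: "Q \<in> ?S" and maxS: "\<And>I. \<lbrakk>I \<in> ?S; Q \<subseteq> I\<rbrakk> \<Longrightarrow> I = Q"
      using exists_maximal_ideal_in[of ?S] by (metis (no_types, lifting) empty_iff)
    then have Q: "primeideal Q R" "C k \<subseteq> Q" "Q \<subset> P" by auto
    have max: "I = Q" if "primeideal I R" "Q \<subseteq> I" "I \<subset> P" for I
      using maxS[of I] that Q(2) by auto
    have iQ: "ideal Q R" using Q(1) by (rule primeideal.axioms)
    obtain x where x: "x \<in> A" "x \<notin> Q" using min[OF Q(1)] Q(3) by blast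
    have xP: "x \<in> P" using x A by blast
    have xc: "x \<in> carrier R" using ideal.Icarr[OF primeideal.axioms(1)[OF P] xP] .
    have "\<exists>q\<in>Q. \<exists>s\<in>carrier R - P. \<exists>u\<in>carrier R. \<exists>m::nat. s \<otimes> z [^] m = q \<oplus> u \<otimes> x" if z: "z \<in> A" for z
    proof -
      have "\<exists>s\<in>carrier R - P. \<exists>m::nat. s \<otimes> z [^] m \<in> adjoin Q x"
      proof (rule minimal_prime_power[OF ideal_adjoin[OF iQ xc] P])
        fix Q' assume "primeideal Q' R" "adjoin Q x \<subseteq> Q'" "Q' \<subseteq> P"
        then show "Q' = P" using max[of Q'] subset_adjoin[OF iQ xc] self_in_adjoin[OF iQ xc] x(2) by blast
      qed (use z A in blast)
      then show ?thesis unfolding mem_adjoin_iff by blast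
    qed
    then obtain q where q: "\<And>z. z \<in> A \<Longrightarrow> q z \<in> Q \<and>
        (\<exists>s\<in>carrier R - P. \<exists>u\<in>carrier R. \<exists>m::nat. s \<otimes> z [^] m = q z \<oplus> u \<otimes> x)"
      by metis
    have "k \<le> n"
    proof (rule Suc.IH[of "q ` (A - {x})" Q])
      show "finite (q ` (A - {x}))" using A by simp
      have "card (q ` (A - {x})) \<le> card (A - {x})" using A by (simp add: card_image_le)
      also have "\<dots> \<le> n" using A x by simp
      finally show "card (q ` (A - {x})) \<le> n" .
      show "q ` (A - {x}) \<subseteq> Q" using q by blast
      fix Q' assume Q': "primeideal Q' R" "q ` (A - {x}) \<subseteq> Q'" "Q' \<subseteq> Q"
      show "Q' = Q"
      proof (rule ccontr)
        assume "Q' \<noteq> Q"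
        then have "Q' \<subset> Q" using Q'(3) by blast
        then obtain P' where P': "primeideal P' R" "Q' \<subseteq> P'" "x \<in> P'" "P' \<subset> P"
          using principal_ideal_theorem[OF Q'(1) Q(1) P _ Q(3) xP] by blast
        have iP': "ideal P' R" using P'(1) by (rule primeideal.axioms)
        have "A \<subseteq> P'"
        proof
          fix z assume z: "z \<in> A"
          show "z \<in> P'"
          proof (cases "z = x")
            case False
            obtain s u and m :: nat where s: "s \<in> carrier R - P" "u \<in> carrier R" "s \<otimes> z [^] m = q z \<oplus> u \<otimes> x"
              using q z by blast
            have zc: "z \<in> carrier R"
              using ideal.Icarr[OF primeideal.axioms(1)[OF P], of z] z A by blast
            have "q z \<in> P'" using False z Q'(2) P'(2) by blast
            then have "s \<otimes> z [^] m \<in> P'"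
              unfolding s(3) using ideal_add[OF iP'] ideal.I_l_closed[OF iP' P'(3) s(2)] by blast
            then have "s \<in> P' \<or> z [^] m \<in> P'" using primeideal.I_prime[OF P'(1)] s(1) zc by auto
            then show ?thesis using s(1) P'(4) prime_pow_mem[OF P'(1) zc] by blast
          qed (use P' in simp)
        qed
        then show False using min[OF P'(1)] P'(4) by blast
      qed
    qed (use C Q Suc in auto)
    then show ?thesis using Suc by simp
  qed simp
qed

text \<open>Only finitely many annihilators of nonzero classes are maximal. Let \<open>W\<close> be
  the elements realising them and choose a finite \<open>F \<subseteq> W\<close> generating a
  largest possible ideal; then each \<open>w \<in> W\<close> lies in \<open>Idl F\<close>. If no
  \<open>(J : f)\<close> were inside \<open>(J : w)\<close>, a single \<open>t\<close> outside
  \<open>(J : w)\<close> would kill all of \<open>F\<close>, hence \<open>w\<close>. So some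
  \<open>(J : f)\<close> is inside \<open>(J : w)\<close>, and equals it by maximality.\<close>

lemma finite_zero_divisor_primes:
  assumes J: "ideal J R"
  obtains F where "finite F"
    "\<And>P. P \<in> F \<Longrightarrow> primeideal P R \<and> (\<exists>w\<in>carrier R - J. P = colon J w)"
    "\<And>z. \<lbrakk>z \<in> carrier R; z \<notin> J\<rbrakk> \<Longrightarrow> \<exists>P\<in>F. colon J z \<subseteq> P"
proof -
  define W where "W = {w \<in> carrier R - J. primeideal (colon J w) R \<and>
    (\<forall>v\<in>carrier R - J. colon J w \<subseteq> colon J v \<longrightarrow> colon J v = colon J w)}"
  have Wc: "W \<subseteq> carrier R" by (auto simp: W_def)
  let ?S = "{Idl F | F. finite F \<and> F \<subseteq> W}"
  have "Idl {} \<in> ?S" by blast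
  moreover have "ideal I R" if "I \<in> ?S" for I
    using that genideal_ideal Wc by (auto dest: subset_trans)
  ultimately obtain M where M: "M \<in> ?S" "\<And>I. \<lbrakk>I \<in> ?S; M \<subseteq> I\<rbrakk> \<Longrightarrow> I = M"
    using exists_maximal_ideal_in[of ?S] by (metis (no_types, lifting) empty_iff)
  then obtain F where F: "finite F" "F \<subseteq> W" "M = Idl F" by blast
  have Fc: "F \<subseteq> carrier R" using F(2) Wc by blast
  have "\<exists>P\<in>colon J ` F. colon J z \<subseteq> P" if z: "z \<in> carrier R" "z \<notin> J" for z
  proof -
    obtain w where w: "w \<in> carrier R" "w \<notin> J" "primeideal (colon J w) R" "colon J z \<subseteq> colon J w"
      "\<And>v. \<lbrakk>v \<in> carrier R; v \<notin> J; colon J w \<subseteq> colon J v\<rbrakk> \<Longrightarrow> colon J v = colon J w"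
      using prime_colon[OF J z] by metis
    then have "w \<in> W" unfolding W_def by simp
    note w = this w(4)
    have wc: "w \<in> carrier R" using w Wc by blast
    have ins: "insert w F \<subseteq> Idl (insert w F)" by (rule genideal_self) (use wc Fc in auto)
    have "Idl F \<subseteq> Idl (insert w F)"
      by (rule genideal_minimal[OF genideal_ideal]) (use wc Fc ins in auto)
    moreover have "Idl (insert w F) \<in> ?S" using F w by blast
    ultimately have "Idl (insert w F) = Idl F" using M(2) F(3) by blast
    then have wF: "w \<in> Idl F" using ins by blast
    have pw: "primeideal (colon J w) R" using w by (simp add: W_def)
    have "\<exists>f\<in>F. colon J f \<subseteq> colon J w"
    proof (rule ccontr)
      assume "\<not> ?thesis"
      then have "\<exists>t\<in>carrier R - colon J w. \<forall>I\<in>colon J ` F. t \<in> I"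
        by (intro exists_in_ideals_not_in_prime[OF _ pw]) (use F Fc ideal_colon[OF J] in auto)
      then obtain t where t: "t \<in> carrier R" "t \<notin> colon J w" "\<And>f. f \<in> F \<Longrightarrow> t \<in> colon J f" by blast
      have "F \<subseteq> colon J t"
      proof
        fix f assume f: "f \<in> F"
        then have "f \<in> carrier R" "f \<otimes> t \<in> J" using t(3)[OF f] Fc by (auto simp: colon_def)
        then show "f \<in> colon J t" using m_comm[of f t] t(1) by (simp add: colon_def)
      qed
      then have "w \<in> colon J t" using wF genideal_minimal[OF ideal_colon[OF J t(1)]] by blast
      then show False using t m_comm[of w t] wc by (simp add: colon_def)
    qed
    then obtain f where f: "f \<in> F" "colon J f \<subseteq> colon J w" by blast
    have "colon J w = colon J f" using f F(2) w(1) unfolding W_def by blast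
    then show ?thesis using f w by blast
  qed
  moreover have "primeideal P R \<and> (\<exists>w\<in>carrier R - J. P = colon J w)" if "P \<in> colon J ` F" for P
    using that F(2) by (auto simp: W_def)
  ultimately show thesis using that[of "colon J ` F"] F(1) by blast
qed

text \<open>The hypotheses say that \<open>I\<close> annihilates no nonzero class modulo
  \<open>J1\<close> or \<open>J2\<close>, so it lies in none of the finitely many maximal
  annihilators, and prime avoidance applies. Two ideals at once are what
  \<open>regular_sequence_exchange\<close> asks for.\<close>

lemma exists_regular_mod:
  assumes I: "ideal I R" and J1: "ideal J1 R" and J2: "ideal J2 R"
    and n1: "\<And>z. \<lbrakk>z \<in> carrier R; I \<subseteq> colon J1 z\<rbrakk> \<Longrightarrow> z \<in> J1"
    and n2: "\<And>z. \<lbrakk>z \<in> carrier R; I \<subseteq> colon J2 z\<rbrakk> \<Longrightarrow> z \<in> J2"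
  obtains x where "x \<in> I" "regular_mod J1 x" "regular_mod J2 x"
proof -
  obtain F1 where F1: "finite F1" "\<And>P. P \<in> F1 \<Longrightarrow> primeideal P R \<and> (\<exists>w\<in>carrier R - J1. P = colon J1 w)"
    "\<And>z. \<lbrakk>z \<in> carrier R; z \<notin> J1\<rbrakk> \<Longrightarrow> \<exists>P\<in>F1. colon J1 z \<subseteq> P"
    using finite_zero_divisor_primes[OF J1] by blast
  obtain F2 where F2: "finite F2" "\<And>P. P \<in> F2 \<Longrightarrow> primeideal P R \<and> (\<exists>w\<in>carrier R - J2. P = colon J2 w)"
    "\<And>z. \<lbrakk>z \<in> carrier R; z \<notin> J2\<rbrakk> \<Longrightarrow> \<exists>P\<in>F2. colon J2 z \<subseteq> P"
    using finite_zero_divisor_primes[OF J2] by blast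
  have "\<exists>x\<in>I. \<forall>P\<in>F1 \<union> F2. x \<notin> P"
  proof (rule prime_avoidance[OF _ I])
    fix P assume "P \<in> F1 \<union> F2"
    then show "primeideal P R \<and> \<not> I \<subseteq> P" using F1(2) F2(2) n1 n2 by (metis DiffE UnE)
  qed (use F1(1) F2(1) in simp)
  then obtain x where x: "x \<in> I" "\<forall>P\<in>F1 \<union> F2. x \<notin> P" by blast
  have xc: "x \<in> carrier R" using ideal.Icarr[OF I x(1)] .
  have mem: "x \<in> colon J a" if "x \<otimes> a \<in> J" "a \<in> carrier R" for J a
    using that xc m_comm[of x a] by (simp add: colon_def)
  have "regular_mod J1 x" unfolding regular_mod_def
    using mem[of _ J1] F1(3) x(2) by blast
  moreover have "regular_mod J2 x" unfolding regular_mod_def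
    using mem[of _ J2] F2(3) x(2) by blast
  ultimately show thesis using that x(1) by blast
qed

end

section \<open>Depth\<close>

context noetherian_local_ring
begin

lemma maximalideal_max_ideal: "maximalideal (max_ideal R) R"
  unfolding max_ideal_def by (rule theI'[OF ex1_maximalideal])

lemma maximalideal_unique: "maximalideal M R \<Longrightarrow> M = max_ideal R"
  using ex1_maximalideal maximalideal_max_ideal by blast

lemma primeideal_max_ideal: "primeideal (max_ideal R) R"
  by (rule maximalideal_prime[OF maximalideal_max_ideal])

lemma ideal_max_ideal: "ideal (max_ideal R) R"
  by (rule primeideal.axioms[OF primeideal_max_ideal])

lemma one_not_in_max_ideal: "\<one> \<notin> max_ideal R"
  using ideal.one_imp_carrier[OF ideal_max_ideal] primeideal.I_notcarr[OF primeideal_max_ideal] by auto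

lemma proper_ideal_subset_max_ideal:
  assumes "ideal I R" "\<one> \<notin> I"
  shows "I \<subseteq> max_ideal R"
proof -
  let ?S = "{K. ideal K R \<and> \<one> \<notin> K \<and> I \<subseteq> K}"
  have "I \<in> ?S" using assms by simp
  then obtain M where MS: "M \<in> ?S" and maxS: "\<And>K. \<lbrakk>K \<in> ?S; M \<subseteq> K\<rbrakk> \<Longrightarrow> K = M"
    using exists_maximal_ideal_in[of ?S] by (metis (no_types, lifting) empty_iff mem_Collect_eq)
  then have M: "ideal M R" "\<one> \<notin> M" "I \<subseteq> M" by auto
  have "maximalideal M R"
  proof (rule maximalidealI[OF M(1)])
    show "carrier R \<noteq> M" using M(2) by auto
    fix K assume K: "ideal K R" "M \<subseteq> K"
    show "K = M \<or> K = carrier R"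
    proof (cases "\<one> \<in> K")
      case True
      then show ?thesis using ideal.one_imp_carrier[OF K(1)] by simp
    next
      case False
      then show ?thesis using maxS[of K] K M(3) by auto
    qed
  qed
  then show ?thesis using maximalideal_unique M(3) by simp
qed

text \<open>Elements outside the maximal ideal are units. Thus \<open>nakayama\<close> becomes
  available at the maximal ideal for arbitrary ideals.\<close>

lemma saturated_compl_max_ideal:
  assumes "ideal I R"
  shows "saturated (carrier R - max_ideal R) I"
  unfolding saturated_def
proof (intro ballI impI)
  fix s r assume s: "s \<in> carrier R - max_ideal R" and r: "r \<in> carrier R" "s \<otimes> r \<in> I"
  have sc: "s \<in> carrier R" using s by simp
  have "\<not> PIdl s \<subseteq> max_ideal R" using s cgenideal_self by blast
  then have "\<one> \<in> PIdl s" using proper_ideal_subset_max_ideal[OF cgenideal_ideal[OF sc]] by blast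
  then obtain u where u: "u \<in> carrier R" "\<one> = u \<otimes> s" unfolding cgenideal_def by blast
  have "u \<otimes> (s \<otimes> r) \<in> I" using ideal.I_l_closed[OF assms r(2) u(1)] .
  moreover have "u \<otimes> (s \<otimes> r) = (u \<otimes> s) \<otimes> r" using u(1) sc r(1) m_assoc by simp
  ultimately show "r \<in> I" using u(2)[symmetric] r(1) by simp
qed

text \<open>An associated prime of \<open>J\<close> lies strictly below one of \<open>J + R x\<close>.\<close>

lemma prime_chain_of_regular_sequence:
  assumes "ideal J R" "regular_sequence_mod J xs" "set xs \<subseteq> max_ideal R"
    and "z \<in> carrier R" "z \<notin> J" "I \<subseteq> colon J z"
  shows "has_prime_chain R I (length xs)"
  using assms
proof (induction xs arbitrary: J z I)
  case Nil
  obtain w where "primeideal (colon J w) R" "colon J z \<subseteq> colon J w"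
    using prime_colon[OF Nil.prems(1,4,5)] by metis
  then have "primeideal (colon J w) R \<and> I \<subseteq> colon J w" using Nil.prems(6) by blast
  then show ?case unfolding has_prime_chain_def by (intro exI[of _ "\<lambda>_. colon J w"]) simp
next
  case (Cons x xs)
  note J = Cons.prems(1)
  have rx: "regular_mod J x" and rxs: "regular_sequence_mod (adjoin J x) xs"
    and xM: "x \<in> max_ideal R" and xsM: "set xs \<subseteq> max_ideal R" using Cons.prems by auto
  have xc: "x \<in> carrier R" using ideal.Icarr[OF ideal_max_ideal xM] .
  have iJx: "ideal (adjoin J x) R" using ideal_adjoin[OF J xc] .
  obtain w where w: "w \<in> carrier R" "w \<notin> J" "primeideal (colon J w) R" "colon J z \<subseteq> colon J w"
    using prime_colon[OF Cons.prems(1,4,5)] by metis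
  define P where "P = colon J w"
  have iP: "ideal P R" unfolding P_def using ideal_colon[OF J w(1)] .
  have "\<exists>z\<in>carrier R. z \<notin> adjoin J x \<and> P \<subseteq> colon J z"
  proof (rule ccontr)
    assume no: "\<not> ?thesis"
    \<comment> \<open>\<open>A\<close> is the ideal of all elements that \<open>P\<close> kills
      modulo \<open>J\<close>. If it lay in \<open>J + R x\<close>, regularity of \<open>x\<close>
      would give \<open>A \<subseteq> J + x A\<close>, and Nakayama's lemma
      \<open>A \<subseteq> J\<close>, against \<open>w \<in> A\<close>.\<close>
    define A where "A = {r \<in> carrier R. P \<subseteq> colon J r}"
    have memA: "r \<in> A \<longleftrightarrow> r \<in> carrier R \<and> (\<forall>p\<in>P. p \<otimes> r \<in> J)" for r
      using ideal_subset[OF iP] m_comm[of r] unfolding A_def colon_def by auto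
    have A: "ideal A R"
    proof (rule idealI_elems)
      show "A \<subseteq> carrier R" by (auto simp: A_def)
      show "\<zero> \<in> A" using ideal_subset[OF iP] ideal_zero[OF J] by (auto simp: memA subset_iff)
      fix a assume a: "a \<in> A"
      show "a \<oplus> b \<in> A" if "b \<in> A" for b
        using a that ideal_subset[OF iP] ideal_add[OF J] by (auto simp: memA r_distr subset_iff)
      show "a \<otimes> r \<in> A" if r: "r \<in> carrier R" for r
        using a r ideal_subset[OF iP] ideal.I_r_closed[OF J]
        by (auto simp: memA m_assoc[symmetric] subset_iff)
      then show "r \<otimes> a \<in> A" if r: "r \<in> carrier R" for r
        using a r m_comm[of r a] by (simp add: memA)
    qed
    have "A \<subseteq> J"
    proof (rule nakayama[OF primeideal_max_ideal A J saturated_compl_max_ideal[OF J] xM])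
      fix a assume a: "a \<in> A"
      then have ac: "a \<in> carrier R" and "a \<in> adjoin J x" using no by (auto simp: A_def)
      then obtain j u where j: "j \<in> J" "u \<in> carrier R" "a = j \<oplus> u \<otimes> x" unfolding mem_adjoin_iff by blast
      have jc: "j \<in> carrier R" using ideal.Icarr[OF J j(1)] .
      have "p \<otimes> u \<in> J" if p: "p \<in> P" for p
      proof -
        have pc: "p \<in> carrier R" using ideal.Icarr[OF iP p] .
        have "x \<otimes> (p \<otimes> u) = p \<otimes> a \<ominus> p \<otimes> j" unfolding j(3) using pc xc jc j(2) by algebra
        also have "\<dots> \<in> J" using a p ideal_minus[OF J] ideal.I_l_closed[OF J j(1) pc] by (simp add: memA)
        finally show ?thesis using regular_modD[OF rx] pc j(2) by simp
      qed
      then have "u \<in> A" using j(2) by (simp add: memA)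
      moreover have "\<one> \<otimes> a = j \<oplus> x \<otimes> u" using j(2,3) ac xc m_comm by simp
      ultimately show "\<exists>s\<in>carrier R - max_ideal R. \<exists>b\<in>J. \<exists>a'\<in>A. s \<otimes> a = b \<oplus> x \<otimes> a'"
        using j(1) one_not_in_max_ideal by blast
    qed
    moreover have "w \<in> A" using w(1) by (simp add: A_def P_def)
    ultimately show False using w(2) by blast
  qed
  then obtain z' where z': "z' \<in> carrier R" "z' \<notin> adjoin J x" "P \<subseteq> colon J z'" by blast
  have sub: "adjoin P x \<subseteq> colon (adjoin J x) z'"
  proof (rule adjoin_subset[OF ideal_colon[OF iJx z'(1)]])
    show "P \<subseteq> colon (adjoin J x) z'" using z'(3) subset_adjoin[OF J xc] by (auto simp: colon_def)
    show "x \<in> colon (adjoin J x) z'"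
      using ideal.I_l_closed[OF iJx self_in_adjoin[OF J xc] z'(1)] xc by (simp add: colon_def)
  qed
  \<comment> \<open>The induction provides a chain over \<open>P + R x\<close>; as \<open>x\<close>
    is regular modulo \<open>J\<close>, it is not in \<open>P\<close>, so \<open>P\<close> extends
    the chain by one step.\<close>
  have "has_prime_chain R (adjoin P x) (length xs)" by (rule Cons.IH[OF iJx rxs xsM z'(1,2) sub])
  moreover have "x \<notin> P"
  proof
    assume "x \<in> P"
    then have "x \<otimes> w \<in> J" using m_comm[of w x] w(1) xc by (simp add: P_def colon_def)
    then show False using regular_modD[OF rx _ w(1)] w(2) by blast
  qed
  then have "P \<subset> adjoin P x" using subset_adjoin[OF iP xc] self_in_adjoin[OF iP xc] by blast
  moreover have "I \<subseteq> P" using Cons.prems(6) w(4) by (simp add: P_def)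
  ultimately show ?case using has_prime_chain_Cons w(3) by (simp add: P_def)
qed

text \<open>By prime avoidance there is \<open>y\<close> regular modulo both \<open>J + R x\<close> and \<open>J + R x1\<close>, where \<open>x1\<close> is
  the head of \<open>xs\<close>; then \<open>y\<close> can be exchanged first for \<open>x1\<close> and then for \<open>x\<close>.\<close>

lemma regular_sequence_exchange:
  assumes "ideal J R" "regular_sequence_mod J xs" "set xs \<subseteq> max_ideal R" "length xs = Suc d"
    and "x \<in> max_ideal R" "regular_mod J x"
  shows "\<exists>ys. regular_sequence_mod (adjoin J x) ys \<and> set ys \<subseteq> max_ideal R \<and> length ys = d"
  using assms
proof (induction d arbitrary: J xs x)
  case 0
  show ?case by (rule exI[of _ "[]"]) simp
next
  case (Suc d)
  let ?M = "max_ideal R"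
  obtain x1 x2 xs' where xs: "xs = x1 # x2 # xs'" using Suc.prems(4) by (auto simp: length_Suc_conv)
  note J = Suc.prems(1) and rx = Suc.prems(6)
  have r1: "regular_mod J x1" and r2: "regular_mod (adjoin J x1) x2"
    and rxs: "regular_sequence_mod (adjoin J x1) (x2 # xs')" and M: "x1 \<in> ?M" "x2 \<in> ?M" "set (x2 # xs') \<subseteq> ?M"
    using Suc.prems by (auto simp: xs)
  have carr: "x \<in> carrier R" "x1 \<in> carrier R" "x2 \<in> carrier R"
    using ideal.Icarr[OF ideal_max_ideal] M Suc.prems(5) by auto
  have iJx: "ideal (adjoin J x) R" and iJ1: "ideal (adjoin J x1) R" using ideal_adjoin J carr by auto
  have n1: "z \<in> adjoin J x1" if z: "z \<in> carrier R" "?M \<subseteq> colon (adjoin J x1) z" for z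
  proof -
    have "x2 \<otimes> z \<in> adjoin J x1" using z M(2) carr m_comm[of z x2] by (auto simp: colon_def)
    then show ?thesis using regular_modD[OF r2] z(1) by blast
  qed
  \<comment> \<open>The socles modulo \<open>J + R x\<close> and \<open>J + R x1\<close> are
    compared through \<open>z x1 = j + w x\<close>: if the maximal ideal kills \<open>z\<close>
    modulo the first, it kills \<open>w\<close> modulo the second, so
    \<open>w \<in> J + R x1\<close> by \<open>n1\<close>, and cancelling \<open>x1\<close> gives
    \<open>z \<in> J + R x\<close>.\<close>
  have n: "z \<in> adjoin J x" if z: "z \<in> carrier R" "?M \<subseteq> colon (adjoin J x) z" for z
  proof -
    have "z \<otimes> x1 \<in> adjoin J x" using z M(1) by (auto simp: colon_def)
    then obtain j w where j: "j \<in> J" "w \<in> carrier R" "z \<otimes> x1 = j \<oplus> w \<otimes> x" unfolding mem_adjoin_iff by blast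
    have jc: "j \<in> carrier R" using ideal.Icarr[OF J j(1)] .
    have "w \<otimes> m \<in> adjoin J x1" if m: "m \<in> ?M" for m
    proof -
      have mc: "m \<in> carrier R" using ideal.Icarr[OF ideal_max_ideal m] .
      have "z \<otimes> m \<in> adjoin J x" using z m by (auto simp: colon_def)
      then obtain i r where i: "i \<in> J" "r \<in> carrier R" "z \<otimes> m = i \<oplus> r \<otimes> x" unfolding mem_adjoin_iff by blast
      have ic: "i \<in> carrier R" using ideal.Icarr[OF J i(1)] .
      have "x \<otimes> (w \<otimes> m \<ominus> r \<otimes> x1) = ((j \<oplus> w \<otimes> x) \<otimes> m \<ominus> j \<otimes> m) \<ominus> x1 \<otimes> (r \<otimes> x)"
        using carr mc jc j(2) i(2) by algebra
      also have "\<dots> = x1 \<otimes> (i \<oplus> r \<otimes> x) \<ominus> j \<otimes> m \<ominus> x1 \<otimes> (r \<otimes> x)"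
        unfolding j(3)[symmetric] i(3)[symmetric] using carr mc jc j(2) i(2) z(1) by algebra
      also have "\<dots> = x1 \<otimes> i \<ominus> j \<otimes> m" using carr mc jc ic j(2) i(2) by algebra
      also have "\<dots> \<in> J"
        using ideal_minus[OF J ideal.I_l_closed[OF J i(1) carr(2)] ideal.I_r_closed[OF J j(1) mc]] .
      finally have "w \<otimes> m \<ominus> r \<otimes> x1 \<in> J" using regular_modD[OF rx] carr mc j(2) i(2) by simp
      moreover have "w \<otimes> m = (w \<otimes> m \<ominus> r \<otimes> x1) \<oplus> r \<otimes> x1" using carr mc j(2) i(2) by algebra
      ultimately show ?thesis unfolding mem_adjoin_iff using i(2) by blast
    qed
    then have "?M \<subseteq> colon (adjoin J x1) w" using ideal_subset[OF ideal_max_ideal] by (auto simp: colon_def)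
    then have "w \<in> adjoin J x1" using n1 j(2) by blast
    then obtain i r where i: "i \<in> J" "r \<in> carrier R" "w = i \<oplus> r \<otimes> x1" unfolding mem_adjoin_iff by blast
    have ic: "i \<in> carrier R" using ideal.Icarr[OF J i(1)] .
    have "x1 \<otimes> (z \<ominus> r \<otimes> x) = (j \<oplus> w \<otimes> x) \<ominus> x1 \<otimes> (r \<otimes> x)"
      unfolding j(3)[symmetric] using carr z(1) i(2) by algebra
    also have "\<dots> = j \<oplus> i \<otimes> x" unfolding i(3) using carr jc ic i(2) by algebra
    also have "\<dots> \<in> J" using ideal_add[OF J j(1) ideal.I_r_closed[OF J i(1) carr(1)]] .
    finally have "z \<ominus> r \<otimes> x \<in> J" using regular_modD[OF r1] carr z(1) i(2) by simp
    moreover have "z = (z \<ominus> r \<otimes> x) \<oplus> r \<otimes> x" using carr z(1) i(2) by algebra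
    ultimately show ?thesis unfolding mem_adjoin_iff using i(2) by blast
  qed
  obtain y where y: "y \<in> ?M" "regular_mod (adjoin J x) y" "regular_mod (adjoin J x1) y"
    using exists_regular_mod[OF ideal_max_ideal iJx iJ1 n n1] by blast
  have yc: "y \<in> carrier R" using ideal.Icarr[OF ideal_max_ideal y(1)] .
  have iJy: "ideal (adjoin J y) R" using ideal_adjoin[OF J yc] .
  have "length (x2 # xs') = Suc d" using Suc.prems(4) xs by simp
  then obtain us where us: "regular_sequence_mod (adjoin (adjoin J x1) y) us" "set us \<subseteq> ?M" "length us = d"
    using Suc.IH[OF iJ1 rxs M(3) _ y(1,3)] by blast
  have "regular_sequence_mod (adjoin J y) (x1 # us)"
    using us(1) regular_mod_adjoin_swap[OF J carr(2) yc r1 y(3)] adjoin_commute[OF J carr(2) yc] by simp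
  then obtain vs where vs: "regular_sequence_mod (adjoin (adjoin J y) x) vs" "set vs \<subseteq> ?M" "length vs = d"
    using Suc.IH[OF iJy _ _ _ Suc.prems(5) regular_mod_adjoin_swap[OF J carr(1) yc rx y(2)], of "x1 # us"]
      us M(1) by auto
  have "regular_sequence_mod (adjoin J x) (y # vs)"
    using vs(1) y(2) adjoin_commute[OF J carr(1) yc] by simp
  then show ?case using vs(2,3) y(1) by (intro exI[of _ "y # vs"]) simp
qed

text \<open>Without a chain of length \<open>d\<close> above \<open>A + B\<close>,
  \<open>prime_chain_of_regular_sequence\<close> shows that \<open>A + B\<close> kills no nonzero
  class, neither modulo \<open>J\<close> (sequence of length \<open>d + 1\<close>) nor modulo
  \<open>J + R x\<close> (length \<open>d\<close>). The first yields the regular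
  \<open>x = a + b\<close>, the second \<open>a \<in> J + R x\<close>.\<close>

lemma prime_chain_above_sum:
  assumes J: "ideal J R" and A: "ideal A R" and B: "ideal B R"
    and AB: "\<And>a b. \<lbrakk>a \<in> A; b \<in> B\<rbrakk> \<Longrightarrow> a \<otimes> b \<in> J" and nJ: "\<not> A \<subseteq> J" "\<not> B \<subseteq> J"
    and xs: "regular_sequence_mod J xs" "set xs \<subseteq> max_ideal R" "length xs = Suc d"
  shows "has_prime_chain R (A <+>\<^bsub>R\<^esub> B) d"
proof (rule ccontr)
  let ?I = "A <+>\<^bsub>R\<^esub> B"
  assume no: "\<not> has_prime_chain R ?I d"
  have iI: "ideal ?I R" using add_ideals[OF A B] .
  have Ac: "a \<in> carrier R" if "a \<in> A" for a using ideal.Icarr[OF A that] .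
  have Bc: "b \<in> carrier R" if "b \<in> B" for b using ideal.Icarr[OF B that] .
  have BA: "b \<otimes> a \<in> J" if "a \<in> A" "b \<in> B" for a b
    using AB[OF that] m_comm[OF Ac[OF that(1)] Bc[OF that(2)]] by simp
  have "\<one> \<notin> A" using AB[of \<one>] Bc nJ(2) by auto
  then have AM: "A \<subseteq> max_ideal R" using proper_ideal_subset_max_ideal[OF A] by blast
  have "\<one> \<notin> B" using BA[of _ \<one>] Ac nJ(1) by auto
  then have BM: "B \<subseteq> max_ideal R" using proper_ideal_subset_max_ideal[OF B] by blast
  have IM: "?I \<subseteq> max_ideal R"
    using AM BM ideal_add[OF ideal_max_ideal] by (auto simp: set_add_def')
  have "z \<in> J" if "z \<in> carrier R" "?I \<subseteq> colon J z" for z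
    using prime_chain_of_regular_sequence[OF J xs(1,2) that(1) _ that(2)] xs(3) no
      has_prime_chain_SucD by auto
  then obtain x where x: "x \<in> ?I" "regular_mod J x" using exists_regular_mod[OF iI J J] by blast
  have xM: "x \<in> max_ideal R" using x(1) IM by blast
  have xc: "x \<in> carrier R" using ideal.Icarr[OF iI x(1)] .
  obtain ys where ys: "regular_sequence_mod (adjoin J x) ys" "set ys \<subseteq> max_ideal R" "length ys = d"
    using regular_sequence_exchange[OF J xs xM x(2)] by blast
  have iJx: "ideal (adjoin J x) R" using ideal_adjoin[OF J xc] .
  obtain a b where ab: "a \<in> A" "b \<in> B" "x = a \<oplus> b" using x(1) by (auto simp: set_add_def')
  note abc = Ac[OF ab(1)] Bc[OF ab(2)]
  have "?I \<subseteq> colon (adjoin J x) a"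
  proof
    fix r assume "r \<in> ?I"
    then obtain u v where uv: "u \<in> A" "v \<in> B" "r = u \<oplus> v" by (auto simp: set_add_def')
    note uvc = Ac[OF uv(1)] Bc[OF uv(2)]
    \<comment> \<open>The bracket lies in \<open>J\<close>, because \<open>A\<close> and
      \<open>B\<close> annihilate each other modulo \<open>J\<close>.\<close>
    have "a \<otimes> r = u \<otimes> x \<oplus> (a \<otimes> v \<ominus> b \<otimes> u)" unfolding uv(3) ab(3) using uvc abc by algebra
    moreover have "a \<otimes> v \<ominus> b \<otimes> u \<in> adjoin J x"
      using ideal_minus[OF J AB[OF ab(1) uv(2)] BA[OF uv(1) ab(2)]] subset_adjoin[OF J xc] by blast
    moreover have "u \<otimes> x \<in> adjoin J x" using ideal.I_l_closed[OF iJx self_in_adjoin[OF J xc] uvc(1)] .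
    ultimately have "a \<otimes> r \<in> adjoin J x" using ideal_add[OF iJx] by simp
    then show "r \<in> colon (adjoin J x) a" using uvc uv(3) by (simp add: colon_def)
  qed
  then have "a \<in> adjoin J x"
    using prime_chain_of_regular_sequence[OF iJx ys(1,2) abc(1)] ys(3) no by blast
  then obtain j c where j: "j \<in> J" "c \<in> carrier R" "a = j \<oplus> c \<otimes> x" unfolding mem_adjoin_iff by blast
  have jc: "j \<in> carrier R" using ideal.Icarr[OF J j(1)] .
  have sat: "r \<in> J" if s: "s \<in> carrier R" "s \<notin> max_ideal R" "s \<otimes> (x \<otimes> r) \<in> J" "r \<in> carrier R" for s r
  proof -
    have "x \<otimes> r \<in> J" using saturated_compl_max_ideal[OF J] s xc unfolding saturated_def by blast
    then show ?thesis using regular_modD[OF x(2)] s(4) by blast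
  qed
  show False
  proof (cases "c \<in> max_ideal R")
    case False
    have "v \<in> J" if v: "v \<in> B" for v
    proof (rule sat[OF j(2) False _ Bc[OF v]])
      have "c \<otimes> (x \<otimes> v) = (j \<oplus> c \<otimes> x) \<otimes> v \<ominus> j \<otimes> v" using j(2) xc jc Bc[OF v] by algebra
      also have "\<dots> \<in> J"
        unfolding j(3)[symmetric] using ideal_minus[OF J AB[OF ab(1) v] ideal.I_r_closed[OF J j(1) Bc[OF v]]] .
      finally show "c \<otimes> (x \<otimes> v) \<in> J" .
    qed
    then show False using nJ(2) by blast
  next
    case True
    have nc: "\<one> \<ominus> c \<notin> max_ideal R"
      using ideal_minus_cancel[OF ideal_max_ideal _ True one_closed] one_not_in_max_ideal by blast
    have "u \<in> J" if u: "u \<in> A" for u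
    proof (rule sat[OF _ nc _ Ac[OF u]])
      have "(\<one> \<ominus> c) \<otimes> (x \<otimes> u) = (x \<ominus> (j \<oplus> c \<otimes> x)) \<otimes> u \<oplus> j \<otimes> u" using j(2) xc jc Ac[OF u] by algebra
      also have "\<dots> = (a \<oplus> b \<ominus> a) \<otimes> u \<oplus> j \<otimes> u" by (simp only: j(3)[symmetric] ab(3)[symmetric])
      also have "\<dots> = b \<otimes> u \<oplus> j \<otimes> u" using abc Ac[OF u] jc by algebra
      also have "\<dots> \<in> J" using ideal_add[OF J BA[OF u ab(2)] ideal.I_r_closed[OF J j(1) Ac[OF u]]] .
      finally show "(\<one> \<ominus> c) \<otimes> (x \<otimes> u) \<in> J" .
    qed (use j(2) in simp)
    then show False using nJ(1) by blast
  qed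
qed

end

section \<open>Quotient rings\<close>

context cring
begin

lemma coset_in_image_iff:
  assumes "ideal I R" "ideal K R" "I \<subseteq> K" "r \<in> carrier R"
  shows "I +> r \<in> (+>) I ` K \<longleftrightarrow> r \<in> K"
proof
  assume "I +> r \<in> (+>) I ` K"
  then obtain k where k: "k \<in> K" "I +> r = I +> k" by blast
  then have "r \<ominus> k \<in> I"
    using quotient_eq_iff_same_a_r_cos[OF assms(1,4)] ideal.Icarr[OF assms(2)] by simp
  then show "r \<in> K" using ideal_minus_cancel[OF assms(2) _ k(1) assms(4)] assms(3) by blast
qed blast

lemma carrier_quotient: "carrier (R Quot I) = (+>) I ` carrier R"
  by (auto simp: FactRing_def A_RCOSETS_def')

lemma quotient_mult:
  "\<lbrakk>ideal I R; a \<in> carrier R; b \<in> carrier R\<rbrakk> \<Longrightarrow> (I +> a) \<otimes>\<^bsub>R Quot I\<^esub> (I +> b) = I +> (a \<otimes> b)"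
  using ideal.rcoset_mult_add by (simp add: FactRing_def)

lemma quotient_one: "\<one>\<^bsub>R Quot I\<^esub> = I +> \<one>"
  by (simp add: FactRing_def)

lemma quotient_vimage_ideal:
  assumes I: "ideal I R" and K: "ideal K (R Quot I)"
  shows "ideal {r \<in> carrier R. I +> r \<in> K} R" "I \<subseteq> {r \<in> carrier R. I +> r \<in> K}"
proof -
  show i: "ideal {r \<in> carrier R. I +> r \<in> K} R"
    using ring_hom_ring.ideal_vimage[OF ideal.rcos_ring_hom_ring[OF I] K] .
  have "I +> i \<in> K" if "i \<in> I" for i
  proof -
    have "I +> i = I" using that I by (simp add: abelian_subgroup.a_rcos_const abelian_subgroupI3 ideal_def is_abelian_group)
    moreover have "\<zero>\<^bsub>R Quot I\<^esub> \<in> K" using K by (simp add: additive_subgroup.zero_closed ideal.axioms(1))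
    ultimately show ?thesis by (simp add: FactRing_def)
  qed
  then show "I \<subseteq> {r \<in> carrier R. I +> r \<in> K}" using ideal_subset[OF I] by auto
qed

lemma quotient_vimage_prime:
  "\<lbrakk>ideal I R; primeideal K (R Quot I)\<rbrakk> \<Longrightarrow> primeideal {r \<in> carrier R. I +> r \<in> K} R"
  using ring_hom_ring.primeideal_vimage[OF ideal.rcos_ring_hom_ring is_cring] .

lemma quotient_image_prime:
  assumes I: "ideal I R" and P: "primeideal P R" and IP: "I \<subseteq> P"
  shows "primeideal ((+>) I ` P) (R Quot I)"
proof (rule primeidealI)
  have iP: "ideal P R" using P by (rule primeideal.axioms)
  show "ideal ((+>) I ` P) (R Quot I)" using ring_ideal_imp_quot_ideal[OF I iP] .
  show "cring (R Quot I)" using ideal.quotient_is_cring[OF I is_cring] .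
  have "\<one> \<notin> P" using ideal.one_imp_carrier[OF iP] primeideal.I_notcarr[OF P] by auto
  then have "I +> \<one> \<notin> (+>) I ` P" using coset_in_image_iff[OF I iP IP] by simp
  then show "carrier (R Quot I) \<noteq> (+>) I ` P" unfolding carrier_quotient by blast
  fix a b assume "a \<in> carrier (R Quot I)" "b \<in> carrier (R Quot I)" and ab: "a \<otimes>\<^bsub>R Quot I\<^esub> b \<in> (+>) I ` P"
  then obtain r s where rs: "r \<in> carrier R" "s \<in> carrier R" "a = I +> r" "b = I +> s"
    unfolding carrier_quotient by blast
  then have "r \<otimes> s \<in> P" using ab coset_in_image_iff[OF I iP IP] quotient_mult[OF I] by simp
  then have "r \<in> P \<or> s \<in> P" using primeideal.I_prime[OF P] rs by blast
  then show "a \<in> (+>) I ` P \<or> b \<in> (+>) I ` P" using rs by blast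
qed

text \<open>Images and preimages under the projection match the primes above \<open>I\<close> with
  those of \<open>R/I\<close> and keep inclusions strict.\<close>

lemma krull_dim_quotient:
  assumes I: "ideal I R"
  shows "krull_dim (R Quot I) = Sup {enat n | n. has_prime_chain R I n}"
proof -
  have "has_prime_chain R I n \<longleftrightarrow>
    (\<exists>P. (\<forall>i\<le>n. primeideal (P i) (R Quot I)) \<and> (\<forall>i<n. P i \<subset> P (Suc i)))" for n
  proof
    assume "has_prime_chain R I n"
    then obtain P where P: "\<forall>i\<le>n. primeideal (P i) R \<and> I \<subseteq> P i" "\<forall>i<n. P i \<subset> P (Suc i)"
      unfolding has_prime_chain_def by blast
    have "(+>) I ` P i \<subset> (+>) I ` P (Suc i)" if i: "i < n" for i
    proof -
      have iP: "ideal (P i) R" "ideal (P (Suc i)) R" "I \<subseteq> P i"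
        using P(1) i by (simp_all add: primeideal.axioms(1))
      obtain r where r: "r \<in> P (Suc i)" "r \<notin> P i" using P(2) i by blast
      then have "I +> r \<notin> (+>) I ` P i"
        using coset_in_image_iff[OF I iP(1,3) ideal.Icarr[OF iP(2) r(1)]] by simp
      then show ?thesis using r(1) P(2) i by blast
    qed
    then show "\<exists>P. (\<forall>i\<le>n. primeideal (P i) (R Quot I)) \<and> (\<forall>i<n. P i \<subset> P (Suc i))"
      using P(1) quotient_image_prime[OF I] by (intro exI[of _ "\<lambda>i. (+>) I ` P i"]) simp
  next
    assume "\<exists>P. (\<forall>i\<le>n. primeideal (P i) (R Quot I)) \<and> (\<forall>i<n. P i \<subset> P (Suc i))"
    then obtain P where P: "\<forall>i\<le>n. primeideal (P i) (R Quot I)" "\<forall>i<n. P i \<subset> P (Suc i)" by blast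
    define C where "C i = {r \<in> carrier R. I +> r \<in> P i}" for i
    have "primeideal (C i) R \<and> I \<subseteq> C i" if "i \<le> n" for i
      unfolding C_def using that P(1) quotient_vimage_prime[OF I] quotient_vimage_ideal(2)[OF I]
        primeideal.axioms(1) by blast
    moreover have "C i \<subset> C (Suc i)" if i: "i < n" for i
    proof -
      obtain a where a: "a \<in> P (Suc i)" "a \<notin> P i" using P(2) i by blast
      have "ideal (P (Suc i)) (R Quot I)" using P(1) i by (simp add: primeideal.axioms(1))
      then have "a \<in> carrier (R Quot I)" using a(1) ideal.Icarr by metis
      then obtain r where "r \<in> carrier R" "a = I +> r" unfolding carrier_quotient by blast
      then have "r \<in> C (Suc i)" "r \<notin> C i" using a by (simp_all add: C_def)
      moreover have "C i \<subseteq> C (Suc i)" using P(2) i by (auto simp: C_def)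
      ultimately show ?thesis by blast
    qed
    ultimately show "has_prime_chain R I n" unfolding has_prime_chain_def by blast
  qed
  then show ?thesis unfolding krull_dim_def by simp
qed

lemma le_krull_dim_quotient: "\<lbrakk>ideal I R; has_prime_chain R I n\<rbrakk> \<Longrightarrow> enat n \<le> krull_dim (R Quot I)"
  unfolding krull_dim_quotient by (rule Sup_upper) blast

lemma krull_dim_quotient_mono:
  assumes "ideal I R" "ideal K R" "I \<subseteq> K"
  shows "krull_dim (R Quot K) \<le> krull_dim (R Quot I)"
proof -
  have "has_prime_chain R I n" if "has_prime_chain R K n" for n
    using that assms(3) unfolding has_prime_chain_def by (meson subset_trans)
  then show ?thesis
    unfolding krull_dim_quotient[OF assms(1)] krull_dim_quotient[OF assms(2)]
    by (intro Sup_subset_mono) blast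
qed

lemma krull_dim_quotient_le: "ideal I R \<Longrightarrow> krull_dim (R Quot I) \<le> krull_dim R"
  unfolding krull_dim_quotient unfolding krull_dim_def
  by (intro Sup_subset_mono) (auto simp: has_prime_chain_def)

end

text \<open>A finite supremum forces a finite set, whose maximum it is; \<open>n \<noteq> 0\<close>
  excludes the empty set, whose supremum is \<open>0\<close>.\<close>

lemma enat_Sup_attained:
  assumes "Sup S = enat n" "n \<noteq> 0"
  shows "enat n \<in> S"
proof -
  have "S \<noteq> {}" "finite S" using assms by (auto simp: Sup_enat_def zero_enat_def split: if_splits)
  then show ?thesis using assms(1) Max_in[of S] by (simp add: Sup_enat_def)
qed

context cring
begin

lemma krull_dim_quotient_strict_mono:
  assumes "primeideal P R" "primeideal Q R" "P \<subset> Q" "krull_dim (R Quot Q) = enat n"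
  shows "enat (Suc n) \<le> krull_dim (R Quot P)"
proof -
  have i: "ideal P R" "ideal Q R" using assms(1,2) by (auto intro: primeideal.axioms)
  have "has_prime_chain R Q n"
  \<comment> \<open>Dimension \<open>0\<close> is not covered by \<open>enat_Sup_attained\<close>;
    there \<open>Q\<close> alone is the chain.\<close>
  proof (cases "n = 0")
    case True
    then show ?thesis
      unfolding has_prime_chain_def using assms(2) by (intro exI[of _ "\<lambda>_. Q"]) simp
  next
    case False
    then have "enat n \<in> {enat n | n. has_prime_chain R Q n}"
      by (intro enat_Sup_attained) (use assms(4) krull_dim_quotient[OF i(2)] in simp_all)
    then show ?thesis by blast
  qed
  then have "has_prime_chain R P (Suc n)" using has_prime_chain_Cons[OF _ assms(1) subset_refl assms(3)] by simp
  then show ?thesis using le_krull_dim_quotient[OF i(1)] by simp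
qed

lemma genideal_quotient_iff:
  assumes I: "ideal I R" and S: "S \<subseteq> carrier R" and r: "r \<in> carrier R"
  shows "I +> r \<in> Idl\<^bsub>R Quot I\<^esub> ((+>) I ` S) \<longleftrightarrow> r \<in> Idl (I \<union> S)"
proof -
  interpret Q: ring "R Quot I" using ideal.quotient_is_ring[OF I] .
  have SQ: "(+>) I ` S \<subseteq> carrier (R Quot I)" unfolding carrier_quotient using S by blast
  have IS: "I \<union> S \<subseteq> carrier R" using S ideal_subset[OF I] by simp
  let ?K = "Idl (I \<union> S)"
  have K: "ideal ?K R" "I \<union> S \<subseteq> ?K" using genideal_ideal[OF IS] genideal_self[OF IS] by simp_all
  have "Idl\<^bsub>R Quot I\<^esub> ((+>) I ` S) \<subseteq> (+>) I ` ?K"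
    by (rule Q.genideal_minimal[OF ring_ideal_imp_quot_ideal[OF I K(1)]]) (use K(2) in blast)
  moreover have "I +> r \<in> (+>) I ` ?K \<longleftrightarrow> r \<in> ?K" using coset_in_image_iff[OF I K(1) _ r] K(2) by simp
  moreover
  let ?V = "{r \<in> carrier R. I +> r \<in> Idl\<^bsub>R Quot I\<^esub> ((+>) I ` S)}"
  note V = quotient_vimage_ideal[OF I Q.genideal_ideal[OF SQ]]
  have "S \<subseteq> ?V" using S Q.genideal_self[OF SQ] by blast
  then have "?K \<subseteq> ?V" by (intro genideal_minimal[OF V(1)]) (use V(2) in blast)
  ultimately show ?thesis by blast
qed

text \<open>Passes from the indexed form used in \<open>regular_sequence\<close> to the recursive
  one. Letting \<open>S\<close> vary allows the head of the list to move into it.\<close>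

lemma regular_sequence_mod_genideal:
  assumes "S \<subseteq> carrier R" "set xs \<subseteq> carrier R"
    and "\<And>i a. \<lbrakk>i < length xs; a \<in> carrier R; xs ! i \<otimes> a \<in> Idl (S \<union> set (take i xs))\<rbrakk>
      \<Longrightarrow> a \<in> Idl (S \<union> set (take i xs))"
  shows "regular_sequence_mod (Idl S) xs"
  using assms
proof (induction xs arbitrary: S)
  case (Cons x xs)
  have "regular_mod (Idl S) x" using Cons.prems(3)[of 0] by (simp add: regular_mod_def)
  moreover have "regular_sequence_mod (Idl (insert x S)) xs"
  proof (rule Cons.IH)
    fix i a
    assume "i < length xs" "a \<in> carrier R" "xs ! i \<otimes> a \<in> Idl (insert x S \<union> set (take i xs))"
    then show "a \<in> Idl (insert x S \<union> set (take i xs))" using Cons.prems(3)[of "Suc i" a] by simp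
  qed (use Cons.prems in auto)
  moreover have "adjoin (Idl S) x = Idl (insert x S)" using adjoin_genideal Cons.prems by simp
  ultimately show ?case by simp
qed simp

lemma regular_sequence_mod_of_quotient:
  assumes J: "ideal J R" and xs: "set xs \<subseteq> carrier R"
    and reg: "regular_sequence (R Quot J) (map ((+>) J) xs)"
  shows "regular_sequence_mod J xs"
proof -
  have Jc: "J \<subseteq> carrier R" using ideal_subset[OF J] .
  have "Idl J = J" using genideal_minimal[OF J] genideal_self[OF Jc] by blast
  moreover have "regular_sequence_mod (Idl J) xs"
  proof (rule regular_sequence_mod_genideal[OF Jc xs])
    fix i a assume i: "i < length xs" and a: "a \<in> carrier R"
      and mem: "xs ! i \<otimes> a \<in> Idl (J \<union> set (take i xs))"
    have xi: "xs ! i \<in> carrier R" using i xs by auto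
    have t: "set (take i xs) \<subseteq> carrier R" using xs set_take_subset by fast
    have "J +> (xs ! i \<otimes> a) \<in> Idl\<^bsub>R Quot J\<^esub> ((+>) J ` set (take i xs))"
      using mem genideal_quotient_iff[OF J t] xi a by simp
    moreover have "J +> a \<in> carrier (R Quot J)" using a by (simp add: carrier_quotient)
    ultimately have "J +> a \<in> Idl\<^bsub>R Quot J\<^esub> ((+>) J ` set (take i xs))"
      using reg i quotient_mult[OF J xi a] unfolding regular_sequence_def by (simp add: take_map)
    then show "a \<in> Idl (J \<union> set (take i xs))" using genideal_quotient_iff[OF J t a] by simp
  qed
  ultimately show ?thesis by simp
qed

end

section \<open>Finite dimension, and lifting regular sequences from a quotient\<close>

context noetherian_local_ring
begin

text \<open>The maximal ideal is minimal over a finite generating set, whose size bounds all chains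
  by the height theorem.\<close>

lemma krull_dim_finite: "krull_dim R \<noteq> \<infinity>"
proof -
  let ?M = "max_ideal R"
  obtain A where A: "A \<subseteq> carrier R" "finite A" "?M = Idl A" using finetely_gen[OF ideal_max_ideal] by blast
  have "n \<le> card A" if P: "\<forall>i\<le>n. primeideal (P i) R" "\<forall>i<n. P i \<subset> P (Suc i)" for n P
  proof (rule height_theorem[OF A(2) order_refl _ primeideal_max_ideal])
    show "A \<subseteq> ?M" using genideal_self[OF A(1)] A(3) by simp
    fix Q assume Q: "primeideal Q R" "A \<subseteq> Q" "Q \<subseteq> ?M"
    then show "Q = ?M" using genideal_minimal[OF primeideal.axioms(1)[OF Q(1)] Q(2)] A(3) by blast
  next
    have p: "primeideal (P n) R" using P(1) by simp
    have i: "ideal (P n) R" using p by (rule primeideal.axioms)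
    then have "\<one> \<notin> P n" using ideal.one_imp_carrier primeideal.I_notcarr[OF p] by metis
    with i show "P n \<subseteq> ?M" by (rule proper_ideal_subset_max_ideal)
  qed (use P in auto)
  then have "krull_dim R \<le> enat (card A)" unfolding krull_dim_def by (intro Sup_least) auto
  then show ?thesis using enat_ile by fastforce
qed

text \<open>As \<open>max_ideal\<close> is a definite description, uniqueness is shown too: a
  maximal ideal of the quotient pulls back to a proper ideal, hence into the maximal ideal of
  \<open>R\<close>.\<close>

lemma max_ideal_quotient:
  assumes J: "ideal J R" "J \<subseteq> max_ideal R"
  shows "max_ideal (R Quot J) = (+>) J ` max_ideal R"
proof -
  let ?M = "max_ideal R" and ?Q = "R Quot J"
  have pM: "primeideal ((+>) J ` ?M) ?Q" using quotient_image_prime[OF J(1) primeideal_max_ideal J(2)] .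
  have max: "maximalideal ((+>) J ` ?M) ?Q"
  proof (rule maximalidealI[OF primeideal.axioms(1)[OF pM] primeideal.I_notcarr[OF pM]])
    fix K assume K: "ideal K ?Q" "(+>) J ` ?M \<subseteq> K" "K \<subseteq> carrier ?Q"
    let ?V = "{r \<in> carrier R. J +> r \<in> K}"
    have "?M \<subseteq> ?V" using K(2) ideal_subset[OF ideal_max_ideal] by blast
    moreover have "?V \<subseteq> carrier R" by blast
    ultimately have "?V = ?M \<or> ?V = carrier R"
      using maximalideal.I_maximal[OF maximalideal_max_ideal quotient_vimage_ideal(1)[OF J(1) K(1)]] by blast
    moreover have KV: "K = (+>) J ` ?V" using K(3) unfolding carrier_quotient by blast
    ultimately show "K = (+>) J ` ?M \<or> K = carrier ?Q"
    proof (elim disjE)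
      assume "?V = ?M"
      with KV show ?thesis by simp
    next
      assume "?V = carrier R"
      with KV show ?thesis unfolding carrier_quotient by simp
    qed
  qed
  have unique: "K = (+>) J ` ?M" if K: "maximalideal K ?Q" for K
  proof -
    have iK: "ideal K ?Q" using K by (rule maximalideal.axioms)
    let ?V = "{r \<in> carrier R. J +> r \<in> K}"
    have "\<one>\<^bsub>?Q\<^esub> \<notin> K"
      using ideal.one_imp_carrier[OF iK] maximalideal.I_notcarr[OF K] by auto
    then have "?V \<subseteq> ?M"
      using proper_ideal_subset_max_ideal[OF quotient_vimage_ideal(1)[OF J(1) iK]] by (simp add: quotient_one)
    moreover have "K \<subseteq> carrier ?Q" using ideal.Icarr[OF iK] by auto
    then have "K = (+>) J ` ?V" unfolding carrier_quotient by blast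
    ultimately have "K \<subseteq> (+>) J ` ?M" by blast
    moreover have "(+>) J ` ?M \<subseteq> carrier ?Q"
      unfolding carrier_quotient using ideal_subset[OF ideal_max_ideal] by blast
    ultimately show ?thesis
      using maximalideal.I_maximal[OF K primeideal.axioms(1)[OF pM]] primeideal.I_notcarr[OF pM] by metis
  qed
  show ?thesis unfolding max_ideal_def[of ?Q] using max unique by (rule the_equality)
qed

lemma regular_sequence_lift:
  assumes J: "ideal J R" "J \<subseteq> max_ideal R"
    and ys: "regular_sequence (R Quot J) ys" "set ys \<subseteq> max_ideal (R Quot J)"
  obtains xs where "regular_sequence_mod J xs" "set xs \<subseteq> max_ideal R" "length xs = length ys"
proof -
  have "ys \<in> lists ((+>) J ` max_ideal R)" using ys(2) max_ideal_quotient[OF J] by auto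
  then obtain xs where xs: "set xs \<subseteq> max_ideal R" "ys = map ((+>) J) xs"
    unfolding lists_image by auto
  have "set xs \<subseteq> carrier R" using xs(1) ideal_subset[OF ideal_max_ideal] by (rule subset_trans)
  then have "regular_sequence_mod J xs" using regular_sequence_mod_of_quotient[OF J(1)] ys(1) xs(2) by simp
  then show thesis using that xs by simp
qed

end

section \<open>Dimension and depth of the quotient by \<pp>\<qq>\<close>

theorem corollary3p7:
  fixes R (structure)
  assumes "noetherian_local_ring R"
    and "primeideal \<pp> R" and "primeideal \<qq> R"
    and "codim R \<pp> = codim R \<qq>"
    and "krull_dim (R Quot (\<pp> <+>\<^bsub>R\<^esub> \<qq>)) + 2 \<le> krull_dim (R Quot \<pp>)"
  shows "\<not> cohen_macaulay (R Quot (\<pp> \<cdot>\<^bsub>R\<^esub> \<qq>))"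
proof
  interpret noetherian_local_ring R by fact
  let ?J = "\<pp> \<cdot>\<^bsub>R\<^esub> \<qq>" and ?I = "\<pp> <+>\<^bsub>R\<^esub> \<qq>"
  assume CM: "cohen_macaulay (R Quot ?J)"
  have i: "ideal \<pp> R" "ideal \<qq> R" using assms(2,3) by (auto intro: primeideal.axioms)
  have iJ: "ideal ?J R" using ideal_prod_is_ideal[OF i] .
  have J: "?J \<subseteq> \<pp>" "?J \<subseteq> \<qq>" using ideal_prod_inter[OF i] by auto
  have "\<one> \<notin> \<pp>" using ideal.one_imp_carrier[OF i(1)] primeideal.I_notcarr[OF assms(2)] by auto
  then have JM: "?J \<subseteq> max_ideal R" using J(1) proper_ideal_subset_max_ideal[OF i(1)] by blast
  have fin: "\<exists>n. krull_dim (R Quot K) = enat n" if "ideal K R" for K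
    using krull_dim_quotient_le[OF that] krull_dim_finite by (cases "krull_dim (R Quot K)") auto
  obtain D where D: "krull_dim R = enat D" using krull_dim_finite by auto
  obtain d where d: "krull_dim (R Quot ?J) = enat d" using fin[OF iJ] by blast
  obtain e where e: "krull_dim (R Quot \<pp>) = enat e" using fin[OF i(1)] by blast
  obtain f where f: "krull_dim (R Quot \<qq>) = enat f" using fin[OF i(2)] by blast
  obtain c where c: "krull_dim (R Quot ?I) = enat c" using fin[OF add_ideals[OF i]] by blast
  \<comment> \<open>With all dimensions finite and at most \<open>D\<close>, equal codimensions can
    be cancelled to \<open>e = f\<close>.\<close>
  have "e \<le> D" "f \<le> D" using krull_dim_quotient_le i e f D by (metis enat_ord_simps(1))+
  moreover have "D - e = D - f" using assms(4) D e f by (simp add: codim_def)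
  ultimately have ef: "e = f" by linarith
  have ce: "c + 2 \<le> e" using assms(5) c e by (simp add: numeral_eq_enat)
  have ed: "e \<le> d" using krull_dim_quotient_mono[OF iJ i(1) J(1)] d e by simp
  have "\<pp> \<noteq> \<qq>"
  proof
    assume "\<pp> = \<qq>"
    moreover have "\<pp> <+>\<^bsub>R\<^esub> \<pp> = \<pp>"
      using ideal_add[OF i(1)] ideal_zero[OF i(1)] ideal.Icarr[OF i(1)]
      by (force simp: set_add_def')
    ultimately show False using c e ce by simp
  qed
  \<comment> \<open>A strict inclusion of primes lowers the finite dimension of the quotient,
    against \<open>e = f\<close>.\<close>
  moreover have "\<not> \<pp> \<subset> \<qq>"
    using krull_dim_quotient_strict_mono[OF assms(2,3) _ f] e ef by auto
  moreover have "\<not> \<qq> \<subset> \<pp>"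
    using krull_dim_quotient_strict_mono[OF assms(3,2) _ e] f ef by auto
  ultimately have nJ: "\<not> \<pp> \<subseteq> ?J" "\<not> \<qq> \<subseteq> ?J" using J by blast+
  \<comment> \<open>Here \<open>d \<ge> e \<ge> 2\<close>, so the depth is positive and attained by
    an actual regular sequence.\<close>
  have "Sup {enat (length xs) | xs. regular_sequence (R Quot ?J) xs \<and> set xs \<subseteq> max_ideal (R Quot ?J)} = enat d"
    using CM d by (simp add: cohen_macaulay_def ring_depth_def)
  then have "enat d \<in> {enat (length xs) | xs. regular_sequence (R Quot ?J) xs \<and> set xs \<subseteq> max_ideal (R Quot ?J)}"
    by (rule enat_Sup_attained) (use ce ed in simp)
  then obtain ys where ys: "regular_sequence (R Quot ?J) ys" "set ys \<subseteq> max_ideal (R Quot ?J)" "length ys = d"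
    by auto
  obtain xs where xs: "regular_sequence_mod ?J xs" "set xs \<subseteq> max_ideal R" "length xs = d"
    using regular_sequence_lift[OF iJ JM ys(1,2)] ys(3) by metis
  \<comment> \<open>A sequence of length \<open>d\<close> gives a chain of length
    \<open>d - 1\<close> above \<pp> + \<qq>, so \<open>d - 1 \<le> c\<close>, whereas
    \<open>c + 2 \<le> e \<le> d\<close>.\<close>
  have "length xs = Suc (d - 1)" using xs(3) ce ed by simp
  then have "has_prime_chain R ?I (d - 1)"
    by (intro prime_chain_above_sum[OF iJ i _ nJ xs(1,2)]) (rule ideal_prod.prod)
  then have "d - 1 \<le> c" using le_krull_dim_quotient[OF add_ideals[OF i]] c by (metis enat_ord_simps(1))
  then show False using ce ed by simp
qed

end
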